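(* Let $\mathbf Y$ be a Gaussian random vector in $\mathbb R^n$ with an unknown mean $\boldsymbol\mu$ and a known nonsingular covariance matrix $\Sigma$, let $\mathbf X$ be a zero-mean Gaussian random vector in $\mathbb R^n$ with covariance matrix $\Sigma$, and let $\mathbf u\in\mathbb R^n$ be a unit vector. Test the null hypothesis $H_0\colon\boldsymbol\mu=\mathbf 0$ versus the alternative $H_1\colon\boldsymbol\mu=\theta\mathbf u$ for real $\theta>0$, using the test $\delta(\mathbf Y):=\mathsf I\{\mathbf Y\notin A\}$ with a symmetric convex set $A\subseteq\mathbb R^n$ such that $\mathsf P(\mathbf X\in A)>0$, so that the null hypothesis is rejected if and only if $\mathbf Y\notin A$, and the size of the test is $\alpha:=\mathsf P(\mathbf X\notin A)$. Then for the power $$\beta_\delta(\theta)=\mathsf P_\theta(\mathbf Y\notin A)=\mathsf P(\mathbf X\notin A-\theta\mathbf u)=1-\mathsf P(\mathbf X\in A-\theta\mathbf u)$$ of the test $\delta$ at any alternative $\boldsymbol\mu=\theta\mathbf u$ with a real $\theta>0$ we have $$1-e^{-\theta^2\langle\mathbf u,\Sigma^{-1}\mathbf u\rangle/2}(1-\alpha)\ge\beta_\delta(\theta)\ge1-r_{\theta\|\Sigma^{-1/2}\mathbf u\|}(a_{\Sigma,A,\mathbf u})(1-\alpha)\ge\alpha,$$ where $\mathsf P_\theta$ denotes the probability computed assuming that $\boldsymbol\mu=\theta\mathbf u$ is the true mean of $\mathbf Y$, and $a_{\Sigma,A,\mathbf u}:=\dfrac{\delta^*(\Sigma^{-1}\mathbf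 u\,|\,A)}{\|\Sigma^{-1/2}\mathbf u\|}\in[0,\infty]$.
   Context: $\langle\cdot,\cdot\rangle$ and $\|\cdot\|$ are the standard inner product and the Euclidean norm on $\mathbb R^n$; $\Sigma^{-1/2}$ is the inverse of the symmetric positive-definite square root of $\Sigma$. A set $A\subseteq\mathbb R^n$ is symmetric if $-A=A$; $A-\theta\mathbf u:=\{\mathbf z-\theta\mathbf u\colon\mathbf z\in A\}$. (Convex sets are Lebesgue measurable; probabilities are integrals of the Gaussian density with respect to Lebesgue measure.) $\mathsf I\{\mathcal A\}$ is the indicator of an assertion $\mathcal A$. The support function of $A$ is $\delta^*(\mathbf v|A):=\sup\{\langle\mathbf z,\mathbf v\rangle\colon\mathbf z\in A\}$ for $\mathbf v\in\mathbb R^n$ (not to be confused with the test $\delta$). $\Phi$ is the standard normal cumulative distribution function on $\mathbb R$. For $t\in[0,\infty)$ and $a\in[0,\infty]$, $r_t(a):=e^{-t^2/2}$ if $a=0$; $r_t(a):=\dfrac{\Phi(t+a)-\Phi(t-a)}{\Phi(a)-\Phi(-a)}$ if $a\in(0,\infty)$; $r_t(a):=1$ if $a=\infty$. *)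

theory Defs
  imports "HOL-Probability.Probability"
begin

definition pos_semidef_mat :: "real^'n^'n \<Rightarrow> bool" where
  "pos_semidef_mat S \<longleftrightarrow> transpose S = S \<and> (\<forall>x. 0 \<le> x \<bullet> (S *v x))"

definition pos_def_mat :: "real^'n^'n \<Rightarrow> bool" where
  "pos_def_mat S \<longleftrightarrow> transpose S = S \<and> (\<forall>x. x \<noteq> 0 \<longrightarrow> 0 < x \<bullet> (S *v x))"

text \<open>Meaningful for positive definite arguments, which have exactly one such root.\<close>

definition sqrt_mat :: "real^'n^'n \<Rightarrow> real^'n^'n" where
  "sqrt_mat S = (THE R. pos_def_mat R \<and> R ** R = S)"

definition inv_sqrt_mat :: "real^'n^'n \<Rightarrow> real^'n^'n" where
  "inv_sqrt_mat S = matrix_inv (sqrt_mat S)"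

definition gauss_density :: "real^'n \<Rightarrow> real^'n^'n \<Rightarrow> real^'n \<Rightarrow> real" where
  "gauss_density \<mu> S x =
     exp (- ((x - \<mu>) \<bullet> (matrix_inv S *v (x - \<mu>))) / 2) / sqrt ((2 * pi) ^ CARD('n) * det S)"

text \<open>Intended for nonsingular covariance matrices, where the Gaussian law has a density.\<close>

definition gaussian_vector ::
  "'w measure \<Rightarrow> ('w \<Rightarrow> real^'n) \<Rightarrow> real^'n \<Rightarrow> real^'n^'n \<Rightarrow> bool" where
  "gaussian_vector M X \<mu> S \<longleftrightarrow>
     prob_space M \<and> distributed M lborel X (\<lambda>x. ennreal (gauss_density \<mu> S x))"

text \<open>
  A convex set is Lebesgue measurable but need not be a Borel set. So for a Borel measurable
  random vector \<open>X\<close> and a convex set \<open>A\<close> the event \<open>X \<in> A\<close> need not be in the sigma-algebra of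
  the underlying space; it is in its completion when the law of \<open>X\<close> has a density.
\<close>

definition prob_that :: "'w measure \<Rightarrow> ('w \<Rightarrow> bool) \<Rightarrow> real" where
  "prob_that M Q = measure (completion M) {\<omega> \<in> space M. Q \<omega>}"

definition test :: "(real^'n) set \<Rightarrow> real^'n \<Rightarrow> nat" where
  "test A y = of_bool (y \<notin> A)"

text \<open>
  For \<open>M\<close> a space on which \<open>Y\<close> follows the null hypothesis this is the size of the test,
  and for an alternative it is the power there.
\<close>

definition reject_prob :: "'w measure \<Rightarrow> ('w \<Rightarrow> real^'n) \<Rightarrow> (real^'n \<Rightarrow> nat) \<Rightarrow> real" where
  "reject_prob M Y d = prob_that M (\<lambda>\<omega>. d (Y \<omega>) = 1)"

definition support_fun :: "real^'n \<Rightarrow> (real^'n) set \<Rightarrow> ereal" where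
  "support_fun v A = (SUP z\<in>A. ereal (z \<bullet> v))"

definition a_coef :: "real^'n^'n \<Rightarrow> (real^'n) set \<Rightarrow> real^'n \<Rightarrow> ereal" where
  "a_coef S A u = support_fun (matrix_inv S *v u) A / ereal (norm (inv_sqrt_mat S *v u))"

definition std_normal_cdf :: "real \<Rightarrow> real" where
  "std_normal_cdf = cdf std_normal_distribution"

text \<open>Only used for \<open>0 \<le> t\<close> and \<open>0 \<le> a \<le> \<infinity>\<close>.\<close>

definition r_fun :: "real \<Rightarrow> ereal \<Rightarrow> real" where
  "r_fun t a =
     (if a = 0 then exp (- t\<^sup>2 / 2)
      else if a = \<infinity> then 1
      else (std_normal_cdf (t + real_of_ereal a) - std_normal_cdf (t - real_of_ereal a)) /
           (std_normal_cdf (real_of_ereal a) - std_normal_cdf (- real_of_ereal a)))"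

end

theory Submission
  imports Defs
begin

text \<open>
  Whitening reduces the claim to the standard Gaussian weight. With \<open>R\<close> the positive definite root of
  \<open>\<Sigma>\<close> and \<open>v = inverse R u\<close>, a linear map \<open>T\<close> (the inverse of \<open>R\<close> followed by a rotation) has
  \<open>|T x|\<^sup>2 = x \<bullet> (inverse \<Sigma> x)\<close> and sends \<open>u\<close> to \<open>|v| k\<close> for a coordinate vector \<open>k\<close>. If \<open>B\<close> is the image
  of the closure of \<open>A\<close>, the acceptance probability at mean \<open>\<theta> u\<close> is, up to one constant,
  \<open>W t = (\<integral> z \<in> B. exp (- |z - t k|\<^sup>2 / 2))\<close> at \<open>t = \<theta> |v|\<close>. The constant cancels.

  Disintegrating along \<open>k\<close> gives \<open>W t = (\<integral> s. m s * exp (- (s - t)\<^sup>2 / 2))\<close>, where \<open>m s\<close> is the Gaussian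
  mass of the slice of \<open>B\<close> at height \<open>s\<close>. Symmetry makes \<open>m\<close> even, so the shifted weight may be
  replaced by \<open>exp (- t\<^sup>2 / 2) * cosh (t s)\<close> times the centred one. As \<open>cosh \<ge> 1\<close>, this yields
  \<open>W t \<ge> exp (- t\<^sup>2 / 2) * W 0\<close>, the upper bound for the power (\<open>shifted_gaussian_symmetric_ge\<close>).

  For the lower bound for the power, convexity enters: by the Prekopa-Leindler inequality the slice
  masses are logarithmically concave, hence, being even, they decrease in \<open>|s|\<close>
  (\<open>section_mass_unimodal\<close>). Since \<open>cosh (t s)\<close> increases in \<open>|s|\<close> and \<open>m\<close> vanishes outside the interval
  \<open>I = [-a, a]\<close>, Chebyshev's association inequality bounds \<open>W t / W 0\<close> by the mean of
  \<open>exp (- t\<^sup>2 / 2) * cosh (t s)\<close> over \<open>I\<close>, that is by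
  \<open>(\<integral> s \<in> I. exp (- (s - t)\<^sup>2 / 2)) / (\<integral> s \<in> I. exp (- s\<^sup>2 / 2))\<close>, which is \<open>r\<close>
  (\<open>shifted_gaussian_symmetric_convex_le\<close>). The same inequality on the whole line, applied to the
  indicator of \<open>I\<close>, shows \<open>r \<le> 1\<close>. The case \<open>a = 0\<close> is excluded, because then \<open>A\<close> would lie in a
  hyperplane and have probability zero.
\<close>

section \<open>The Prekopa-Leindler inequality\<close>

text \<open>
  The supremum of \<open>A\<close> may be infinite or not attained, so the measure of \<open>A\<close> is exhausted through points
  that belong to \<open>A\<close>. They serve as hinges in the one-dimensional Brunn-Minkowski inequality.
\<close>

lemma emeasure_Int_atMost_approx:
  fixes A :: "real set" and p :: ennreal
  assumes A[measurable]: "A \<in> sets borel" and p: "p < emeasure lborel A"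
  shows "\<exists>a\<in>A. p < emeasure lborel (A \<inter> {..a})"
proof -
  have "A \<noteq> {}" using p by auto
  have mono: "p < emeasure lborel (A \<inter> {..a})" if "p < emeasure lborel (A \<inter> {..c})" "c \<le> a" for a c
    by (rule less_le_trans[OF that(1) emeasure_mono]) (use that in auto)
  show ?thesis
  proof (cases "bdd_above A \<and> Sup A \<in> A")
    case True
    then have "A \<inter> {..Sup A} = A" by (auto intro: cSup_upper)
    then show ?thesis using True p by (intro bexI[of _ "Sup A"]) simp_all
  next
    case not_attained: False
    obtain c :: "nat \<Rightarrow> real" where c: "incseq c" "A \<subseteq> (\<Union>n. {..c n})" "\<And>n. \<exists>a\<in>A. c n \<le> a"
    proof (cases "bdd_above A")
      case True
      show ?thesis
      proof
        show "incseq (\<lambda>n. Sup A - 1 / real (Suc n))"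
          by (intro monoI diff_left_mono divide_left_mono) auto
        show "A \<subseteq> (\<Union>n. {..Sup A - 1 / real (Suc n)})"
        proof
          fix x assume "x \<in> A"
          with True have "x \<le> Sup A" by (rule cSup_upper[rotated])
          with not_attained True \<open>x \<in> A\<close> have "0 < Sup A - x" by (cases "x = Sup A") auto
          then obtain n where "1 / real (Suc n) < Sup A - x" by (rule nat_approx_posE)
          then show "x \<in> (\<Union>n. {..Sup A - 1 / real (Suc n)})" by (auto intro!: exI[of _ n])
        qed
        show "\<exists>a\<in>A. Sup A - 1 / real (Suc n) \<le> a" for n
        proof -
          have "Sup A - 1 / real (Suc n) < Sup A" by simp
          then obtain a where "a \<in> A" "Sup A - 1 / real (Suc n) < a"
            using less_cSup_iff[OF \<open>A \<noteq> {}\<close> True] by blast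
          then show ?thesis by (auto intro: less_imp_le)
        qed
      qed
    next
      case False
      show ?thesis
      proof
        show "incseq (\<lambda>n. real n)" by (intro monoI) auto
        show "A \<subseteq> (\<Union>n. {..real n})" by (auto intro: real_arch_simple)
        show "\<exists>a\<in>A. real n \<le> a" for n
          using False unfolding bdd_above_def by (meson linear)
      qed
    qed
    have "emeasure lborel A = emeasure lborel (\<Union>n. A \<inter> {..c n})"
      using c(2) by (intro arg_cong[where f="emeasure lborel"]) auto
    also have "\<dots> = (SUP n. emeasure lborel (A \<inter> {..c n}))"
      using c(1) by (intro SUP_emeasure_incseq[symmetric]) (auto simp: mono_def incseq_def intro: order_trans)
    finally have "p < (SUP n. emeasure lborel (A \<inter> {..c n}))" using p by simp
    then obtain n where n: "p < emeasure lborel (A \<inter> {..c n})" unfolding less_SUP_iff by blast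
    from c(3) obtain a where "a \<in> A" "c n \<le> a" by blast
    then show ?thesis using mono[OF n] by blast
  qed
qed

lemma emeasure_Int_atMost_SUP:
  fixes A :: "real set"
  assumes "A \<in> sets borel"
  shows "(SUP a\<in>A. emeasure lborel (A \<inter> {..a})) = emeasure lborel A"
proof (rule antisym)
  show "(SUP a\<in>A. emeasure lborel (A \<inter> {..a})) \<le> emeasure lborel A"
    using assms by (intro SUP_least emeasure_mono) auto
  show "emeasure lborel A \<le> (SUP a\<in>A. emeasure lborel (A \<inter> {..a}))"
  proof (rule dense_le)
    fix p assume "p < emeasure lborel A"
    with emeasure_Int_atMost_approx[OF assms] obtain a
      where "a \<in> A" "p < emeasure lborel (A \<inter> {..a})" by blast
    then show "p \<le> (SUP a\<in>A. emeasure lborel (A \<inter> {..a}))"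
      by (intro SUP_upper2[of a]) auto
  qed
qed

lemma mult_SUP_add_le_ennreal:
  fixes c d :: ennreal
  assumes "I \<noteq> {}" "\<And>i. i \<in> I \<Longrightarrow> k * f i + c \<le> d"
  shows "k * (SUP i\<in>I. f i) + c \<le> d"
proof (cases "c = \<top>")
  case True
  with assms show ?thesis by (metis ennreal_add_eq_top equals0I top.extremum_unique)
next
  case False
  then show ?thesis
    using assms
    by (simp add: ennreal_SUP_add_left[symmetric] SUP_mult_left_ennreal SUP_least)
qed

lemma emeasure_lborel_affine_image:
  fixes A :: "real set"
  assumes [measurable]: "A \<in> sets borel" and c: "c \<noteq> 0"
  shows "emeasure lborel ((\<lambda>x. t + c * x) ` A) = ennreal \<bar>c\<bar> * emeasure lborel A"
    and "(\<lambda>x. t + c * x) ` A \<in> sets borel"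
proof -
  have eq: "(\<lambda>x. t + c * x) ` A = (\<lambda>y. (y - t) / c) -` A \<inter> space borel"
  proof (intro equalityI subsetI)
    fix y assume "y \<in> (\<lambda>y. (y - t) / c) -` A \<inter> space borel"
    moreover have "y = t + c * ((y - t) / c)" using c by simp
    ultimately show "y \<in> (\<lambda>x. t + c * x) ` A" by blast
  qed (use c in auto)
  show [measurable]: "(\<lambda>x. t + c * x) ` A \<in> sets borel"
    unfolding eq by measurable
  have vim: "(\<lambda>x. t + c * x) -` ((\<lambda>x. t + c * x) ` A) = A" using c by auto
  have "emeasure lborel ((\<lambda>x. t + c * x) ` A)
     = emeasure (density (distr lborel borel (\<lambda>x. t + c * x)) (\<lambda>_. ennreal \<bar>c\<bar>)) ((\<lambda>x. t + c * x) ` A)"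
    using lborel_real_affine[OF c, of t] by simp
  also have "\<dots> = ennreal \<bar>c\<bar> * emeasure lborel A"
    by (simp add: emeasure_density nn_integral_cmult_indicator emeasure_distr vim)
  finally show "emeasure lborel ((\<lambda>x. t + c * x) ` A) = ennreal \<bar>c\<bar> * emeasure lborel A" .
qed

lemma emeasure_Int_atLeast_SUP:
  fixes B :: "real set"
  assumes [measurable]: "B \<in> sets borel"
  shows "(SUP b\<in>B. emeasure lborel (B \<inter> {b..})) = emeasure lborel B"
proof -
  have neg: "emeasure lborel (uminus ` S) = emeasure lborel S" "uminus ` S \<in> sets borel"
    if "S \<in> sets borel" for S :: "real set"
    using emeasure_lborel_affine_image[OF that, of "-1" 0] by simp_all
  have "emeasure lborel (B \<inter> {b..}) = emeasure lborel (uminus ` B \<inter> {..- b})" for b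
    using neg(1)[of "B \<inter> {b..}"] by (simp add: image_Int[OF inj_uminus])
  then have "(SUP b\<in>B. emeasure lborel (B \<inter> {b..}))
      = (SUP a\<in>uminus ` B. emeasure lborel (uminus ` B \<inter> {..a}))"
    by (simp add: image_comp comp_def)
  also have "\<dots> = emeasure lborel B"
    using neg[of B] by (simp add: emeasure_Int_atMost_SUP)
  finally show ?thesis .
qed

text \<open>
  For \<open>a \<in> A\<close> and \<open>b \<in> B\<close>, combining the part of \<open>A\<close> below \<open>a\<close> with the single point \<open>b\<close>, and the single
  point \<open>a\<close> with the part of \<open>B\<close> above \<open>b\<close>, gives two subsets of \<open>C\<close> that meet in at most one point.
  Letting \<open>a\<close> and \<open>b\<close> exhaust the two sets gives the claim.
\<close>

lemma Brunn_Minkowski_real: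
  fixes A B C :: "real set" and l :: real
  assumes [measurable]: "A \<in> sets borel" "B \<in> sets borel" "C \<in> sets borel"
    and l: "0 < l" "l < 1" and ne: "A \<noteq> {}" "B \<noteq> {}"
    and C: "\<And>x y. x \<in> A \<Longrightarrow> y \<in> B \<Longrightarrow> (1 - l) * x + l * y \<in> C"
  shows "ennreal (1 - l) * emeasure lborel A + ennreal l * emeasure lborel B \<le> emeasure lborel C"
proof -
  have one: "ennreal (1 - l) * emeasure lborel (A \<inter> {..a}) + ennreal l * emeasure lborel (B \<inter> {b..})
      \<le> emeasure lborel C" if ab: "a \<in> A" "b \<in> B" for a b
  proof -
    let ?L = "(\<lambda>x. l * b + (1 - l) * x) ` (A \<inter> {..a})"
    let ?R = "(\<lambda>x. (1 - l) * a + l * x) ` (B \<inter> {b..})"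
    have L: "emeasure lborel ?L = ennreal (1 - l) * emeasure lborel (A \<inter> {..a})" "?L \<in> sets borel"
      using emeasure_lborel_affine_image[of "A \<inter> {..a}" "1 - l" "l * b"] l by auto
    have R: "emeasure lborel ?R = ennreal l * emeasure lborel (B \<inter> {b..})" "?R \<in> sets borel"
      using emeasure_lborel_affine_image[of "B \<inter> {b..}" l "(1 - l) * a"] l by auto
    have m: "x \<le> l * b + (1 - l) * a" if "x \<in> ?L" for x
      using that l by auto
    have m': "l * b + (1 - l) * a \<le> x" if "x \<in> ?R" for x
      using that l by auto
    have "?L \<inter> ?R \<subseteq> {l * b + (1 - l) * a}"
      using m m' by fastforce
    then have "?L \<inter> ?R \<in> null_sets lborel"
      by (rule null_sets_subset[rotated 2]) (use L(2) R(2) in auto)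
    then have "emeasure lborel ?L + emeasure lborel ?R = emeasure lborel (?L \<union> ?R)"
      using L(2) R(2) by (intro emeasure_Un'[symmetric]) auto
    also have "\<dots> \<le> emeasure lborel C"
      using ab by (intro emeasure_mono) (auto dest: C simp: add.commute)
    finally show ?thesis using L R by simp
  qed
  have supA: "(SUP a\<in>A. emeasure lborel (A \<inter> {..a})) = emeasure lborel A"
    by (rule emeasure_Int_atMost_SUP) simp
  have supB: "(SUP b\<in>B. emeasure lborel (B \<inter> {b..})) = emeasure lborel B"
    by (rule emeasure_Int_atLeast_SUP) simp
  have "ennreal (1 - l) * emeasure lborel A + ennreal l * emeasure lborel (B \<inter> {b..}) \<le> emeasure lborel C"
    if "b \<in> B" for b
    unfolding supA[symmetric]
    by (rule mult_SUP_add_le_ennreal) (use one that ne in auto)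
  then show ?thesis
    unfolding supB[symmetric] add.commute[of "ennreal (1-l) * _"]
    by (intro mult_SUP_add_le_ennreal) (use ne in \<open>auto simp: add.commute\<close>)
qed

text \<open>
  The layer cake formula, with the levels measured in units of \<open>c\<close>: in the Prekopa-Leindler inequality
  each function gets its own unit, which makes the level sets comparable.
\<close>

lemma nn_integral_layer_cake:
  fixes f :: "'a \<Rightarrow> ennreal"
  assumes [measurable]: "f \<in> borel_measurable M" and M: "sigma_finite_measure M" and c: "0 < c"
  shows "(\<integral>\<^sup>+x. f x \<partial>M)
    = ennreal c * (\<integral>\<^sup>+t. indicator {0<..} t * emeasure M {x\<in>space M. ennreal (c * t) < f x} \<partial>lborel)"
proof -
  interpret pair_sigma_finite M "lborel :: real measure"
    using M by (intro pair_sigma_finite.intro sigma_finite_lborel)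
  have pt: "a = ennreal c * (\<integral>\<^sup>+t. indicator {t. 0 < t \<and> ennreal (c * t) < a} t \<partial>lborel)" for a
  proof (cases a)
    case top
    have "ennreal c \<noteq> 0" using c by (simp add: ennreal_eq_0_iff)
    moreover have "{t::real. 0 < t \<and> ennreal (c * t) < a} = {0<..}" using top by auto
    moreover have "emeasure lborel {0::real<..} = \<top>"
    proof -
      have "ennreal (real n) \<le> emeasure lborel {0::real<..}" for n
        using emeasure_mono[of "{0<..<real n}" "{0<..}" lborel] by fastforce
      then show ?thesis
        by (metis ennreal_SUP_of_nat_eq_top SUP_le_iff ennreal_of_nat_eq_real_of_nat top.extremum_unique)
    qed
    ultimately show ?thesis using top by (simp add: ennreal_mult_top)
  next
    case (real r)
    then have "{t. 0 < t \<and> ennreal (c * t) < a} = {0<..<r / c}"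
      using c by (auto simp: ennreal_less_iff field_simps)
    then show ?thesis using real c by (simp add: ennreal_mult[symmetric])
  qed
  have "(\<integral>\<^sup>+x. f x \<partial>M)
      = (\<integral>\<^sup>+x. ennreal c * (\<integral>\<^sup>+t. indicator {t. 0 < t \<and> ennreal (c * t) < f x} t \<partial>lborel) \<partial>M)"
    by (rule nn_integral_cong) (rule pt)
  also have "\<dots> = ennreal c * (\<integral>\<^sup>+x. \<integral>\<^sup>+t. indicator {t. 0 < t \<and> ennreal (c * t) < f x} t \<partial>lborel \<partial>M)"
    by (rule nn_integral_cmult) simp
  also have "(\<integral>\<^sup>+x. \<integral>\<^sup>+t. indicator {t. 0 < t \<and> ennreal (c * t) < f x} t \<partial>lborel \<partial>M)
     = (\<integral>\<^sup>+t. \<integral>\<^sup>+x. indicator {t. 0 < t \<and> ennreal (c * t) < f x} t \<partial>M \<partial>lborel)"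
    using Fubini'[of "\<lambda>x t. indicator {t. 0 < t \<and> ennreal (c * t) < f x} t"] by simp
  also have "\<dots> = (\<integral>\<^sup>+t. indicator {0<..} t * emeasure M {x\<in>space M. ennreal (c * t) < f x} \<partial>lborel)"
  proof (rule nn_integral_cong)
    fix t :: real
    have "(\<integral>\<^sup>+x. indicator {t. 0 < t \<and> ennreal (c * t) < f x} t \<partial>M)
       = (\<integral>\<^sup>+x. indicator {0<..} t * indicator {x\<in>space M. ennreal (c * t) < f x} x \<partial>M)"
      by (intro nn_integral_cong) (auto simp: indicator_def)
    also have "\<dots> = indicator {0<..} t * emeasure M {x\<in>space M. ennreal (c * t) < f x}"
      by (rule nn_integral_cmult_indicator) measurable
    finally show "(\<integral>\<^sup>+x. indicator {t. 0 < t \<and> ennreal (c * t) < f x} t \<partial>M)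
       = indicator {0<..} t * emeasure M {x\<in>space M. ennreal (c * t) < f x}" .
  qed
  finally show ?thesis .
qed

text \<open>
  The relation \<open>a powr (1 - l) * b powr l \<le> c\<close> for extended nonnegative numbers, with the convention that
  it holds when \<open>a = 0\<close> or \<open>b = 0\<close>. The quantification over real levels avoids powers of \<open>\<infinity>\<close>, so
  that sections with infinite integral need no separate treatment in the induction on the dimension.
\<close>

definition geom_mean_le :: "real \<Rightarrow> ennreal \<Rightarrow> ennreal \<Rightarrow> ennreal \<Rightarrow> bool" where
  "geom_mean_le l a b c \<longleftrightarrow> (\<forall>p q. 0 < p \<longrightarrow> 0 < q \<longrightarrow> ennreal p < a \<longrightarrow> ennreal q < b \<longrightarrow>
     ennreal (p powr (1 - l) * q powr l) \<le> c)"

lemma less_nn_integral_truncate: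
  fixes f :: "'a \<Rightarrow> ennreal"
  assumes [measurable]: "f \<in> borel_measurable M" and p: "p < (\<integral>\<^sup>+x. f x \<partial>M)"
  obtains n :: nat where "p < (\<integral>\<^sup>+x. min (f x) (of_nat n) \<partial>M)"
proof -
  have "(SUP n. min (f x) (of_nat n)) = f x" for x
  proof (rule antisym)
    show "(SUP n. min (f x) (of_nat n)) \<le> f x" by (rule SUP_least) simp
    show "f x \<le> (SUP n. min (f x) (of_nat n))"
    proof (rule dense_le)
      fix y assume y: "y < f x"
      then obtain r where "y = ennreal r" "0 \<le> r" by (cases y) auto
      moreover obtain n where "r < real n" using reals_Archimedean2 by blast
      ultimately have "y < of_nat n"
        by (simp add: ennreal_of_nat_eq_real_of_nat ennreal_less_iff)
      then show "y \<le> (SUP n. min (f x) (of_nat n))"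
        using y by (intro SUP_upper2[of n]) auto
    qed
  qed
  then have "(\<integral>\<^sup>+x. f x \<partial>M) = (\<integral>\<^sup>+x. (SUP n. min (f x) (of_nat n)) \<partial>M)" by simp
  also have "\<dots> = (SUP n. \<integral>\<^sup>+x. min (f x) (of_nat n) \<partial>M)"
    by (rule nn_integral_monotone_convergence_SUP)
       (auto simp: incseq_def le_fun_def intro: min.coboundedI2)
  finally have "p < (SUP n. \<integral>\<^sup>+x. min (f x) (of_nat n) \<partial>M)" using p by simp
  then show thesis using that unfolding less_SUP_iff by blast
qed

lemma weighted_AM_GM:
  fixes a b l :: real
  assumes "0 < a" "0 < b" "0 < l" "l < 1"
  shows "a powr (1 - l) * b powr l \<le> (1 - l) * a + l * b"
proof -
  have "ln ((1 - l) * a + l * b) \<ge> (1 - l) * ln a + l * ln b"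
    using assms concave_onD[OF ln_concave, of l a b] by simp
  then have "exp ((1 - l) * ln a + l * ln b) \<le> exp (ln ((1 - l) * a + l * b))" by simp
  also have "\<dots> = (1 - l) * a + l * b" using assms by (simp add: add_pos_pos)
  finally show ?thesis using assms by (simp add: powr_def exp_add mult.commute)
qed

text \<open>
  After truncation, \<open>f\<close> and \<open>g\<close> have finite suprema \<open>F\<close> and \<open>G\<close>. Measured relative to these suprema, the
  level sets at heights between 0 and 1 are nonempty and their combinations lie in the corresponding
  level set of \<open>h\<close>. Brunn-Minkowski and integration over the heights bound the integral of \<open>h\<close>, in units
  of the geometric mean of \<open>F\<close> and \<open>G\<close>, by an arithmetic mean, which exceeds the geometric one.
\<close>

lemma Prekopa_Leindler_real:
  fixes f g h :: "real \<Rightarrow> ennreal" and l :: real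
  assumes [measurable]: "f \<in> borel_measurable borel" "g \<in> borel_measurable borel" "h \<in> borel_measurable borel"
    and l: "0 < l" "l < 1"
    and fgh: "\<And>x y. geom_mean_le l (f x) (g y) (h ((1 - l) * x + l * y))"
  shows "geom_mean_le l (\<integral>\<^sup>+x. f x \<partial>lborel) (\<integral>\<^sup>+x. g x \<partial>lborel) (\<integral>\<^sup>+x. h x \<partial>lborel)"
  unfolding geom_mean_le_def
proof (intro allI impI)
  fix p q :: real
  assume p: "0 < p" "ennreal p < (\<integral>\<^sup>+x. f x \<partial>lborel)" and q: "0 < q" "ennreal q < (\<integral>\<^sup>+x. g x \<partial>lborel)"
  \<comment> \<open>The heights are normalised by the suprema so that no level set below height 1 is empty.\<close>
  have norm: "\<exists>F>0. ennreal (p / F) \<le> (\<integral>\<^sup>+t. indicator {0<..<1} t * emeasure lborel {x. ennreal (F * t) < f x} \<partial>lborel)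
      \<and> (\<forall>t\<in>{0<..<1}. \<exists>x. ennreal (F * t) < f x)"
    if [measurable]: "f \<in> borel_measurable borel" and p: "0 < p" "ennreal p < (\<integral>\<^sup>+x. f x \<partial>lborel)" for f :: "real \<Rightarrow> ennreal" and p
  proof -
    obtain n :: nat where n: "ennreal p < (\<integral>\<^sup>+x. min (f x) (of_nat n) \<partial>lborel)"
      using less_nn_integral_truncate[OF _ p(2)] by auto
    \<comment> \<open>The supremum is positive because the truncated integral exceeds \<open>p > 0\<close>.\<close>
    define F where "F = (SUP x. min (f x) (of_nat n))"
    have "F \<le> of_nat n" unfolding F_def by (intro SUP_least) simp
    then have Ft: "F \<noteq> \<top>" by (auto simp: top_unique)
    have F_upper: "min (f x) (of_nat n) \<le> F" for x unfolding F_def by (rule SUP_upper) simp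
    have "F \<noteq> 0"
    proof
      assume "F = 0"
      then have "min (f x) (of_nat n) = 0" for x using F_upper[of x] by simp
      then show False using n by simp
    qed
    then obtain r where r: "F = ennreal r" "0 < r" using Ft by (cases F) (auto simp: order.strict_iff_order)
    have "ennreal p \<le> (\<integral>\<^sup>+x. min (f x) (of_nat n) \<partial>lborel)" using n by simp
    also have "\<dots> = ennreal r * (\<integral>\<^sup>+t. indicator {0<..} t * emeasure lborel {x\<in>space lborel. ennreal (r * t) < min (f x) (of_nat n)} \<partial>lborel)"
      by (rule nn_integral_layer_cake) (use r sigma_finite_lborel in auto)
    also have "\<dots> \<le> ennreal r * (\<integral>\<^sup>+t. indicator {0<..<1} t * emeasure lborel {x. ennreal (r * t) < f x} \<partial>lborel)"
    proof (intro mult_left_mono nn_integral_mono)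
      fix t :: real
      show "indicator {0<..} t * emeasure lborel {x\<in>space lborel. ennreal (r * t) < min (f x) (of_nat n)}
        \<le> indicator {0<..<1} t * emeasure lborel {x. ennreal (r * t) < f x}"
      proof (cases "0 < t \<and> 1 \<le> t")
        case True
        then have "\<not> ennreal (r * t) < min (f x) (of_nat n)" for x
        proof -
          have "r \<le> r * t" using True r by simp
          then have "F \<le> ennreal (r * t)" using r by (simp add: ennreal_leI)
          with F_upper[of x] show ?thesis by (simp only: not_less order_trans)
        qed
        then have "{x\<in>space lborel. ennreal (r * t) < min (f x) (of_nat n)} = {}" by blast
        then show ?thesis by (simp only: emeasure_empty mult_zero_right zero_le)
      next
        case False
        then show ?thesis by (auto simp: indicator_def intro!: emeasure_mono)
      qed
    qed simp
    finally have *: "ennreal p \<le> ennreal r * (\<integral>\<^sup>+t. indicator {0<..<1} t * emeasure lborel {x. ennreal (r * t) < f x} \<partial>lborel)" .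
    have "ennreal (p / r) = ennreal (1 / r) * ennreal p" using r p by (simp add: ennreal_mult[symmetric])
    also have "\<dots> \<le> ennreal (1 / r) * (ennreal r * (\<integral>\<^sup>+t. indicator {0<..<1} t * emeasure lborel {x. ennreal (r * t) < f x} \<partial>lborel))"
      by (rule mult_left_mono[OF *]) simp
    also have "\<dots> = (\<integral>\<^sup>+t. indicator {0<..<1} t * emeasure lborel {x. ennreal (r * t) < f x} \<partial>lborel)"
      using r by (simp add: mult.assoc[symmetric] ennreal_mult[symmetric])
    finally have "ennreal (p / r) \<le> (\<integral>\<^sup>+t. indicator {0<..<1} t * emeasure lborel {x. ennreal (r * t) < f x} \<partial>lborel)" .
    moreover have "\<exists>x. ennreal (r * t) < f x" if "t \<in> {0<..<1}" for t
    proof -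
      have "ennreal (r * t) < F" using r that by (simp add: ennreal_less_iff)
      then show ?thesis unfolding F_def less_SUP_iff by auto
    qed
    ultimately show ?thesis using r by blast
  qed
  obtain F where F: "0 < F" "ennreal (p / F) \<le> (\<integral>\<^sup>+t. indicator {0<..<1} t * emeasure lborel {x. ennreal (F * t) < f x} \<partial>lborel)"
      "\<And>t. t\<in>{0<..<1} \<Longrightarrow> \<exists>x. ennreal (F * t) < f x"
    using norm[of f p] p by auto
  obtain G where G: "0 < G" "ennreal (q / G) \<le> (\<integral>\<^sup>+t. indicator {0<..<1} t * emeasure lborel {x. ennreal (G * t) < g x} \<partial>lborel)"
      "\<And>t. t\<in>{0<..<1} \<Longrightarrow> \<exists>x. ennreal (G * t) < g x"
    using norm[of g q] q by auto
  define H where "H = F powr (1 - l) * G powr l"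
  have H: "0 < H" unfolding H_def using F G by simp
  have level: "ennreal (H * t) < h ((1 - l) * x + l * y)"
    if t: "t \<in> {0<..<1}" and x: "ennreal (F * t) < f x" and y: "ennreal (G * t) < g y" for t x y
  proof -
    \<comment> \<open>The defining levels of the geometric mean are strict, so slightly higher levels are chosen.\<close>
    obtain z where z: "ennreal (F * t) < z" "z < f x" using dense[OF x] by blast
    then obtain p' where p': "z = ennreal p'" "F * t < p'"
      using t F by (cases z) (auto simp: ennreal_less_iff)
    have pos: "0 < F * t" "0 < G * t" using t F G by auto
    obtain z2 where z2: "ennreal (G * t) < z2" "z2 < g y" using dense[OF y] by blast
    then obtain q' where q': "z2 = ennreal q'" "G * t < q'"
      using t G by (cases z2) (auto simp: ennreal_less_iff)
    have "H * t = (F * t) powr (1 - l) * (G * t) powr l"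
      using t F G by (simp add: H_def powr_mult powr_diff mult_ac)
    also have "\<dots> < p' powr (1 - l) * q' powr l"
      using pos p' q' l by (intro mult_strict_mono powr_less_mono2) auto
    finally have "ennreal (H * t) < ennreal (p' powr (1 - l) * q' powr l)"
      using t H by (simp add: ennreal_less_iff)
    also have "\<dots> \<le> h ((1 - l) * x + l * y)"
      using fgh[of x y] z z2 p' q' pos unfolding geom_mean_le_def by auto
    finally show ?thesis .
  qed
  have "ennreal (p powr (1 - l) * q powr l) = ennreal H * ennreal ((p / F) powr (1 - l) * (q / G) powr l)"
    using p q F G H by (simp add: ennreal_mult[symmetric] H_def powr_divide)
  also have "\<dots> \<le> ennreal H * ennreal ((1 - l) * (p / F) + l * (q / G))"
    using p q F G l by (intro mult_left_mono ennreal_leI weighted_AM_GM) auto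
  also have "\<dots> = ennreal H * (ennreal (1 - l) * ennreal (p / F) + ennreal l * ennreal (q / G))"
    using p q F G l by (simp add: ennreal_mult[symmetric])
  also have "\<dots> \<le> ennreal H * (ennreal (1 - l) * (\<integral>\<^sup>+t. indicator {0<..<1} t * emeasure lborel {x. ennreal (F * t) < f x} \<partial>lborel)
      + ennreal l * (\<integral>\<^sup>+t. indicator {0<..<1} t * emeasure lborel {x. ennreal (G * t) < g x} \<partial>lborel))"
    using F G by (intro mult_left_mono add_mono) auto
  also have "\<dots> = ennreal H * (\<integral>\<^sup>+t. ennreal (1 - l) * (indicator {0<..<1} t * emeasure lborel {x. ennreal (F * t) < f x})
      + ennreal l * (indicator {0<..<1} t * emeasure lborel {x. ennreal (G * t) < g x}) \<partial>lborel)"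
    by (subst nn_integral_add) (simp_all add: nn_integral_cmult)
  also have "\<dots> \<le> ennreal H * (\<integral>\<^sup>+t. indicator {0<..} t * emeasure lborel {x\<in>space lborel. ennreal (H * t) < h x} \<partial>lborel)"
  proof (intro mult_left_mono nn_integral_mono)
    fix t :: real
    show "ennreal (1 - l) * (indicator {0<..<1} t * emeasure lborel {x. ennreal (F * t) < f x})
      + ennreal l * (indicator {0<..<1} t * emeasure lborel {x. ennreal (G * t) < g x})
      \<le> indicator {0<..} t * emeasure lborel {x\<in>space lborel. ennreal (H * t) < h x}"
    proof (cases "t \<in> {0<..<1}")
      case True
      then show ?thesis
        using F(3)[OF True] G(3)[OF True] level[OF True] l
        by (auto intro!: Brunn_Minkowski_real)
    qed auto
  qed simp
  also have "\<dots> = (\<integral>\<^sup>+x. h x \<partial>lborel)"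
    by (rule nn_integral_layer_cake[symmetric]) (use H sigma_finite_lborel in auto)
  finally show "ennreal (p powr (1 - l) * q powr l) \<le> (\<integral>\<^sup>+x. h x \<partial>lborel)" .
qed

text \<open>
  Induction on the number of coordinates: integrating out one coordinate by the one-dimensional
  inequality leaves functions that satisfy the hypothesis again. Points are extensional functions with
  the value \<open>undefined\<close> outside \<open>I\<close>, and a convex combination of \<open>undefined\<close> with itself is \<open>undefined\<close>, so
  combinations of points are points.
\<close>

lemma Prekopa_Leindler_PiM:
  fixes f g h :: "('i \<Rightarrow> real) \<Rightarrow> ennreal" and l :: real
  assumes "finite I" and l: "0 < l" "l < 1"
    and "f \<in> borel_measurable (\<Pi>\<^sub>M i\<in>I. lborel)" "g \<in> borel_measurable (\<Pi>\<^sub>M i\<in>I. lborel)"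
      "h \<in> borel_measurable (\<Pi>\<^sub>M i\<in>I. lborel)"
    and "\<And>x y. x \<in> space (\<Pi>\<^sub>M i\<in>I. lborel) \<Longrightarrow> y \<in> space (\<Pi>\<^sub>M i\<in>I. lborel) \<Longrightarrow>
      geom_mean_le l (f x) (g y) (h (\<lambda>i. (1 - l) * x i + l * y i))"
  shows "geom_mean_le l (\<integral>\<^sup>+x. f x \<partial>(\<Pi>\<^sub>M i\<in>I. lborel)) (\<integral>\<^sup>+x. g x \<partial>(\<Pi>\<^sub>M i\<in>I. lborel))
    (\<integral>\<^sup>+x. h x \<partial>(\<Pi>\<^sub>M i\<in>I. lborel))"
  using assms(1,4-)
proof (induction I arbitrary: f g h rule: finite_induct)
  case empty
  interpret product_sigma_finite "\<lambda>_::'i. lborel :: real measure"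
    by standard
  have "(\<lambda>i::'i. (1 - l) * undefined + l * undefined) = (\<lambda>_. undefined)"
    by (simp add: fun_eq_iff algebra_simps)
  then show ?case
    using empty(4)[of "\<lambda>_. undefined" "\<lambda>_. undefined"] by (simp add: nn_integral_empty)
next
  case (insert k I)
  interpret product_sigma_finite "\<lambda>_::'i. lborel :: real measure"
    by standard
  note [measurable] = insert.prems(1-3)
  have upd: "(\<lambda>i. (1 - l) * (x(k := s)) i + l * (y(k := r)) i)
      = (\<lambda>i. (1 - l) * x i + l * y i)(k := (1 - l) * s + l * r)" for x y :: "'i \<Rightarrow> real" and s r
    by (auto simp: fun_eq_iff)
  have sec: "(\<lambda>s. f (x(k := s))) \<in> borel_measurable borel"
    if "f \<in> borel_measurable (\<Pi>\<^sub>M i\<in>insert k I. lborel)" "x \<in> space (\<Pi>\<^sub>M i\<in>I. lborel)"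
    for f :: "('i \<Rightarrow> real) \<Rightarrow> ennreal" and x
  proof -
    have "(\<lambda>s. x(k := s)) \<in> measurable lborel (\<Pi>\<^sub>M i\<in>insert k I. lborel)"
      using that(2) by (intro measurable_fun_upd[where J=I]) auto
    from measurable_compose[OF this that(1)] show ?thesis by simp
  qed
  show ?case
    unfolding product_nn_integral_insert[OF insert.hyps insert.prems(1)]
      product_nn_integral_insert[OF insert.hyps insert.prems(2)]
      product_nn_integral_insert[OF insert.hyps insert.prems(3)]
  proof (rule insert.IH)
    fix x y :: "'i \<Rightarrow> real"
    assume xy: "x \<in> space (\<Pi>\<^sub>M i\<in>I. lborel)" "y \<in> space (\<Pi>\<^sub>M i\<in>I. lborel)"
    have xyk: "x(k := s) \<in> space (\<Pi>\<^sub>M i\<in>insert k I. lborel)"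
      "y(k := s) \<in> space (\<Pi>\<^sub>M i\<in>insert k I. lborel)" for s
      using xy by (auto simp: space_PiM PiE_def extensional_def)
    have comb: "(\<lambda>i. (1 - l) * x i + l * y i) \<in> space (\<Pi>\<^sub>M i\<in>I. lborel)"
      using xy by (auto simp: space_PiM PiE_def extensional_def algebra_simps)
    show "geom_mean_le l (\<integral>\<^sup>+s. f (x(k := s)) \<partial>lborel) (\<integral>\<^sup>+s. g (y(k := s)) \<partial>lborel)
      (\<integral>\<^sup>+s. h ((\<lambda>i. (1 - l) * x i + l * y i)(k := s)) \<partial>lborel)"
    proof (rule Prekopa_Leindler_real[OF _ _ _ l])
      show "geom_mean_le l (f (x(k := s))) (g (y(k := r)))
          (h ((\<lambda>i. (1 - l) * x i + l * y i)(k := (1 - l) * s + l * r)))" for s r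
        using insert.prems(4)[OF xyk] unfolding upd .
    qed (intro sec insert.prems xy comb)+
  qed measurable
qed

lemma geom_mean_le_self:
  assumes "geom_mean_le l a a c" shows "a \<le> c"
proof (rule dense_le)
  fix z assume z: "z < a"
  then obtain p where p: "z = ennreal p" "0 \<le> p" by (cases z) auto
  show "z \<le> c"
  proof (cases "p = 0")
    case False
    then have "ennreal (p powr (1 - l) * p powr l) \<le> c"
      using assms p z unfolding geom_mean_le_def by (metis less_le)
    then show ?thesis using p False by (simp add: powr_add[symmetric])
  qed (use p in simp)
qed

section \<open>Shifts of the Gaussian weight on the line\<close>

text \<open>
  Integrating the rearrangement inequality \<open>f x * g x + f y * g y \<le> f x * g y + f y * g x\<close> over both
  variables gives twice the claim.
\<close>

lemma nn_integral_Chebyshev_association: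
  fixes f g :: "'a \<Rightarrow> ennreal"
  assumes [measurable]: "f \<in> borel_measurable M" "g \<in> borel_measurable M"
    and opp: "\<And>x y. x \<in> space M \<Longrightarrow> y \<in> space M \<Longrightarrow> f x \<le> f y \<and> g y \<le> g x \<or> f y \<le> f x \<and> g x \<le> g y"
  shows "(\<integral>\<^sup>+x. f x * g x \<partial>M) * emeasure M (space M) \<le> (\<integral>\<^sup>+x. f x \<partial>M) * (\<integral>\<^sup>+x. g x \<partial>M)"
proof -
  have ord: "a * c + b * d \<le> a * d + b * c" if "a \<le> b" "d \<le> c" for a b c d :: ennreal
  proof -
    from that obtain e e' where "b = a + e" "c = d + e'" by (auto simp: le_iff_add)
    then show ?thesis by (simp add: distrib_left distrib_right add_ac)
  qed
  have pt: "f x * g x + f y * g y \<le> f x * g y + f y * g x" if "x \<in> space M" "y \<in> space M" for x y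
    using opp[OF that] ord[of "f x" "f y" "g y" "g x"] ord[of "f y" "f x" "g x" "g y"]
    by (auto simp: add.commute)
  have "(\<integral>\<^sup>+x. f x * g x \<partial>M) * emeasure M (space M) + (\<integral>\<^sup>+x. f x * g x \<partial>M) * emeasure M (space M)
      = (\<integral>\<^sup>+x. (\<integral>\<^sup>+y. f x * g x + f y * g y \<partial>M) \<partial>M)"
    by (simp add: nn_integral_add nn_integral_cmult mult.commute[of _ "emeasure M (space M)"])
  also have "\<dots> \<le> (\<integral>\<^sup>+x. (\<integral>\<^sup>+y. f x * g y + f y * g x \<partial>M) \<partial>M)"
    by (intro nn_integral_mono pt)
  also have "\<dots> = (\<integral>\<^sup>+x. f x \<partial>M) * (\<integral>\<^sup>+x. g x \<partial>M) + (\<integral>\<^sup>+x. f x \<partial>M) * (\<integral>\<^sup>+x. g x \<partial>M)"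
    by (simp add: nn_integral_add nn_integral_multc nn_integral_cmult)
  finally have "2 * ((\<integral>\<^sup>+x. f x * g x \<partial>M) * emeasure M (space M)) \<le> 2 * ((\<integral>\<^sup>+x. f x \<partial>M) * (\<integral>\<^sup>+x. g x \<partial>M))"
    by (simp add: mult_2)
  then show ?thesis by (subst (asm) ennreal_mult_le_mult_iff) auto
qed

lemma nn_integral_lborel_uminus:
  fixes f :: "real \<Rightarrow> ennreal"
  assumes [measurable]: "f \<in> borel_measurable borel"
  shows "(\<integral>\<^sup>+s. f (- s) \<partial>lborel) = (\<integral>\<^sup>+s. f s \<partial>lborel)"
proof -
  have "(\<integral>\<^sup>+s. f s \<partial>lborel) = (\<integral>\<^sup>+s. f s \<partial>distr lborel borel uminus)" by (simp add: lborel_distr_uminus)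
  also have "\<dots> = (\<integral>\<^sup>+s. f (- s) \<partial>lborel)" by (rule nn_integral_distr) auto
  finally show ?thesis by simp
qed

text \<open>
  For an even function the weights centred at \<open>t\<close> and at \<open>-t\<close> have the same effect, and their average
  is \<open>exp (- t\<^sup>2 / 2) * cosh (t * s)\<close> times the centred weight.
\<close>

lemma nn_integral_even_shifted_gaussian:
  fixes F :: "real \<Rightarrow> ennreal" and t :: real
  assumes [measurable]: "F \<in> borel_measurable borel" and even: "\<And>s. F (- s) = F s"
  shows "(\<integral>\<^sup>+s. F s * ennreal (exp (- (s - t)\<^sup>2 / 2)) \<partial>lborel)
    = (\<integral>\<^sup>+s. F s * ennreal (exp (- t\<^sup>2 / 2) * cosh (t * s)) * ennreal (exp (- s\<^sup>2 / 2)) \<partial>lborel)"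
    (is "?L = ?R")
proof -
  have "?L = (\<integral>\<^sup>+s. F (- s) * ennreal (exp (- (- s - t)\<^sup>2 / 2)) \<partial>lborel)"
    by (rule nn_integral_lborel_uminus[symmetric]) simp
  then have "?L + ?L = (\<integral>\<^sup>+s. F s * ennreal (exp (- (s - t)\<^sup>2 / 2)) + F s * ennreal (exp (- (- s - t)\<^sup>2 / 2)) \<partial>lborel)"
    by (simp add: nn_integral_add even)
  also have "\<dots> = (\<integral>\<^sup>+s. 2 * (F s * ennreal (exp (- t\<^sup>2 / 2) * cosh (t * s)) * ennreal (exp (- s\<^sup>2 / 2))) \<partial>lborel)"
  proof (rule nn_integral_cong)
    fix s
    have e1: "exp (- (s - t)\<^sup>2 / 2) = exp (- t\<^sup>2 / 2) * exp (t * s) * exp (- s\<^sup>2 / 2)"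
      by (simp add: exp_add[symmetric] power2_eq_square field_simps)
    have e2: "exp (- (- s - t)\<^sup>2 / 2) = exp (- t\<^sup>2 / 2) * exp (- (t * s)) * exp (- s\<^sup>2 / 2)"
      by (simp add: exp_add[symmetric] power2_eq_square field_simps)
    have "exp (- (s - t)\<^sup>2 / 2) + exp (- (- s - t)\<^sup>2 / 2) = 2 * ((exp (- t\<^sup>2 / 2) * cosh (t * s)) * exp (- s\<^sup>2 / 2))"
      unfolding e1 e2 by (simp add: cosh_field_def field_simps)
    then have "ennreal (exp (- (s - t)\<^sup>2 / 2)) + ennreal (exp (- (- s - t)\<^sup>2 / 2))
        = 2 * (ennreal (exp (- t\<^sup>2 / 2) * cosh (t * s)) * ennreal (exp (- s\<^sup>2 / 2)))"
      by (simp add: ennreal_plus[symmetric] ennreal_mult[symmetric] ennreal_numeral[symmetric] del: ennreal_plus ennreal_numeral)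
    then show "F s * ennreal (exp (- (s - t)\<^sup>2 / 2)) + F s * ennreal (exp (- (- s - t)\<^sup>2 / 2))
      = 2 * (F s * ennreal (exp (- t\<^sup>2 / 2) * cosh (t * s)) * ennreal (exp (- s\<^sup>2 / 2)))"
      by (simp only: distrib_left[symmetric] mult_ac)
  qed
  also have "\<dots> = 2 * ?R" unfolding cosh_field_def by (rule nn_integral_cmult) measurable
  finally have "2 * ?L = 2 * ?R" by (simp add: mult_2)
  then show ?thesis by (simp add: ennreal_mult_cancel_left)
qed

text \<open>
  Under the Gaussian weight restricted to \<open>I\<close>, the function \<open>F\<close> decreases and \<open>cosh (t * s)\<close> increases in
  \<open>\<bar>s\<bar>\<close>, so they are negatively associated. The quotient of the two integrals over \<open>I\<close> alone is the
  function \<open>r\<close> when \<open>I\<close> is an interval.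
\<close>

lemma shifted_gaussian_unimodal_le:
  fixes F :: "real \<Rightarrow> ennreal" and t :: real and I :: "real set"
  assumes [measurable]: "F \<in> borel_measurable borel" "I \<in> sets borel"
    and F: "\<And>s r. \<bar>s\<bar> \<le> \<bar>r\<bar> \<Longrightarrow> F r \<le> F s" and I: "\<And>s. - s \<in> I \<longleftrightarrow> s \<in> I"
  shows "(\<integral>\<^sup>+s. F s * indicator I s * ennreal (exp (- (s - t)\<^sup>2 / 2)) \<partial>lborel)
      * (\<integral>\<^sup>+s. indicator I s * ennreal (exp (- s\<^sup>2 / 2)) \<partial>lborel)
    \<le> (\<integral>\<^sup>+s. indicator I s * ennreal (exp (- (s - t)\<^sup>2 / 2)) \<partial>lborel)
      * (\<integral>\<^sup>+s. F s * indicator I s * ennreal (exp (- s\<^sup>2 / 2)) \<partial>lborel)"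
proof -
  define g where "g s = ennreal (exp (- t\<^sup>2 / 2) * cosh (t * s))" for s
  define N where "N = density lborel (\<lambda>s. indicator I s * ennreal (exp (- s\<^sup>2 / 2)))"
  have [measurable]: "g \<in> borel_measurable borel" unfolding g_def cosh_field_def by measurable
  have F_even: "F (- s) = F s" for s using F[of s "- s"] F[of "- s" s] by simp
  have ind: "indicator I (- s) = indicator I s" for s using I[of s] by (simp add: indicator_def)
  have g: "g s \<le> g r" if "\<bar>s\<bar> \<le> \<bar>r\<bar>" for s r
  proof -
    have "\<bar>t * s\<bar> \<le> \<bar>t * r\<bar>" using that by (simp add: abs_mult mult_left_mono)
    then have "cosh (t * s) \<le> cosh (t * r)"
      using cosh_real_nonneg_le_iff[of "\<bar>t * s\<bar>" "\<bar>t * r\<bar>"] by (simp add: cosh_real_abs)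
    then show ?thesis unfolding g_def by (intro ennreal_leI mult_left_mono) auto
  qed
  have *: "F r \<le> F s \<and> g s \<le> g r \<or> F s \<le> F r \<and> g r \<le> g s" for r s
    using F g by (cases "\<bar>s\<bar> \<le> \<bar>r\<bar>") auto
  have "(\<integral>\<^sup>+s. F s * g s \<partial>N) * emeasure N (space N) \<le> (\<integral>\<^sup>+s. F s \<partial>N) * (\<integral>\<^sup>+s. g s \<partial>N)"
    by (rule nn_integral_Chebyshev_association) (use * in \<open>auto simp: N_def\<close>)
  moreover have "(\<integral>\<^sup>+s. F s * g s \<partial>N) = (\<integral>\<^sup>+s. F s * indicator I s * ennreal (exp (- (s - t)\<^sup>2 / 2)) \<partial>lborel)"
    using nn_integral_even_shifted_gaussian[of "\<lambda>s. F s * indicator I s" t, folded g_def]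
    by (simp add: F_even ind N_def nn_integral_density mult_ac)
  moreover have "(\<integral>\<^sup>+s. g s \<partial>N) = (\<integral>\<^sup>+s. indicator I s * ennreal (exp (- (s - t)\<^sup>2 / 2)) \<partial>lborel)"
    using nn_integral_even_shifted_gaussian[of "\<lambda>s. indicator I s" t, folded g_def]
    by (simp add: ind N_def nn_integral_density mult_ac)
  moreover have "(\<integral>\<^sup>+s. F s \<partial>N) = (\<integral>\<^sup>+s. F s * indicator I s * ennreal (exp (- s\<^sup>2 / 2)) \<partial>lborel)"
    by (simp add: N_def nn_integral_density mult_ac)
  moreover have "emeasure N (space N) = (\<integral>\<^sup>+s. indicator I s * ennreal (exp (- s\<^sup>2 / 2)) \<partial>lborel)"
    by (simp add: N_def emeasure_density)
  ultimately show ?thesis by (simp add: mult.commute)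
qed

section \<open>Slices of a symmetric convex set\<close>

lemma nn_integral_lborel_split:
  fixes F :: "'a::euclidean_space \<Rightarrow> ennreal"
  assumes [measurable]: "F \<in> borel_measurable borel" and k: "k \<in> Basis"
  shows "(\<integral>\<^sup>+z. F z \<partial>lborel)
    = (\<integral>\<^sup>+s. \<integral>\<^sup>+y. F (s *\<^sub>R k + (\<Sum>b\<in>Basis - {k}. y b *\<^sub>R b)) \<partial>(\<Pi>\<^sub>M b\<in>Basis - {k}. lborel) \<partial>lborel)"
proof -
  interpret product_sigma_finite "\<lambda>_::'a. lborel :: real measure" by standard
  have Basis: "insert k (Basis - {k}) = Basis" using k by auto
  have "(\<integral>\<^sup>+z. F z \<partial>lborel) = (\<integral>\<^sup>+f. F (\<Sum>b\<in>Basis. f b *\<^sub>R b) \<partial>(\<Pi>\<^sub>M b\<in>Basis. lborel))"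
    by (subst lborel_eq) (simp add: nn_integral_distr)
  also have "\<dots> = (\<integral>\<^sup>+f. F (\<Sum>b\<in>Basis. f b *\<^sub>R b) \<partial>(\<Pi>\<^sub>M b\<in>insert k (Basis - {k}). lborel))"
    by (simp only: Basis)
  also have "\<dots> = (\<integral>\<^sup>+s. \<integral>\<^sup>+y. F (\<Sum>b\<in>Basis. (y(k := s)) b *\<^sub>R b) \<partial>(\<Pi>\<^sub>M b\<in>Basis - {k}. lborel) \<partial>lborel)"
    by (rule product_nn_integral_insert_rev) (auto simp: Basis)
  also have "(\<lambda>s y. (\<Sum>b\<in>Basis. (y(k := s)) b *\<^sub>R b)) = (\<lambda>s y. s *\<^sub>R k + (\<Sum>b\<in>Basis - {k}. y b *\<^sub>R b))"
    using k by (intro ext) (simp add: sum.remove[of _ k])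
  finally show ?thesis by (simp add: fun_eq_iff)
qed

lemma nn_integral_PiM_lborel_uminus:
  fixes f :: "('i \<Rightarrow> real) \<Rightarrow> ennreal"
  assumes I: "finite I" and f: "f \<in> borel_measurable (\<Pi>\<^sub>M i\<in>I. lborel)"
  shows "(\<integral>\<^sup>+y. f (\<lambda>i\<in>I. - y i) \<partial>(\<Pi>\<^sub>M i\<in>I. lborel)) = (\<integral>\<^sup>+y. f y \<partial>(\<Pi>\<^sub>M i\<in>I. lborel))"
proof -
  interpret product_sigma_finite "\<lambda>_::'i. lborel :: real measure" by standard
  let ?P = "\<Pi>\<^sub>M i\<in>I. (lborel :: real measure)"
  have m[measurable]: "(\<lambda>y. \<lambda>i\<in>I. - y i) \<in> measurable ?P ?P" by measurable
  have "distr ?P ?P (\<lambda>y. \<lambda>i\<in>I. - y i) = ?P"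
  proof (rule PiM_eqI[OF I])
    fix A :: "'i \<Rightarrow> real set" assume A: "\<And>i. i \<in> I \<Longrightarrow> A i \<in> sets lborel"
    have "(\<lambda>y. \<lambda>i\<in>I. - y i) -` Pi\<^sub>E I A \<inter> space ?P = Pi\<^sub>E I (\<lambda>i. uminus -` A i)"
      by (auto simp: space_PiM PiE_def Pi_def)
    moreover have "emeasure lborel (uminus -` A i) = emeasure lborel (A i)" if "i \<in> I" for i
    proof -
      have "emeasure lborel (A i) = emeasure (distr lborel borel uminus) (A i)" by (simp add: lborel_distr_uminus)
      also have "\<dots> = emeasure lborel (uminus -` A i)"
        using A[OF that] by (subst emeasure_distr) auto
      finally show ?thesis by simp
    qed
    moreover have "uminus -` A i \<in> sets lborel" if "i \<in> I" for i
      using measurable_sets[of uminus borel borel "A i"] A[OF that] by simp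
    ultimately show "emeasure (distr ?P ?P (\<lambda>y. \<lambda>i\<in>I. - y i)) (Pi\<^sub>E I A) = (\<Prod>i\<in>I. emeasure lborel (A i))"
      using A I by (subst emeasure_distr) (auto simp: emeasure_PiM sets_PiM_I_finite)
  qed simp
  then have "(\<integral>\<^sup>+y. f y \<partial>?P) = (\<integral>\<^sup>+y. f y \<partial>distr ?P ?P (\<lambda>y. \<lambda>i\<in>I. - y i))" by simp
  also have "\<dots> = (\<integral>\<^sup>+y. f (\<lambda>i\<in>I. - y i) \<partial>?P)" using f by (intro nn_integral_distr) auto
  finally show ?thesis by simp
qed

text \<open>
  The standard Gaussian mass, up to normalisation, of the slice of \<open>B\<close> at height \<open>s\<close> along the coordinate
  vector \<open>k\<close>.
\<close>

definition section_mass :: "'a::euclidean_space set \<Rightarrow> 'a \<Rightarrow> real \<Rightarrow> ennreal" where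
  "section_mass B k s = (\<integral>\<^sup>+y. indicator B (s *\<^sub>R k + (\<Sum>b\<in>Basis - {k}. y b *\<^sub>R b))
     * ennreal (exp (- (\<Sum>b\<in>Basis - {k}. (y b)\<^sup>2) / 2)) \<partial>(\<Pi>\<^sub>M b\<in>Basis - {k}. lborel))"

lemma measurable_section_mass [measurable]:
  fixes B :: "'a::euclidean_space set"
  assumes [measurable]: "B \<in> sets borel"
  shows "section_mass B k \<in> borel_measurable borel"
proof -
  interpret product_sigma_finite "\<lambda>_::'a. lborel :: real measure" by standard
  interpret P: sigma_finite_measure "\<Pi>\<^sub>M b\<in>Basis - {k::'a}. (lborel :: real measure)"
    by (rule sigma_finite) simp
  show ?thesis
    unfolding section_mass_def[abs_def] by (rule P.borel_measurable_nn_integral) measurable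
qed

lemma norm_shifted_split:
  fixes k :: "'a::euclidean_space"
  assumes k: "k \<in> Basis"
  shows "(norm (s *\<^sub>R k + (\<Sum>b\<in>Basis - {k}. y b *\<^sub>R b) - t *\<^sub>R k))\<^sup>2 = (s - t)\<^sup>2 + (\<Sum>b\<in>Basis - {k}. (y b)\<^sup>2)"
proof -
  let ?z = "s *\<^sub>R k + (\<Sum>b\<in>Basis - {k}. y b *\<^sub>R b) - t *\<^sub>R k"
  have z: "?z \<bullet> b = (if b = k then s - t else y b)" if "b \<in> Basis" for b
  proof -
    have "(\<Sum>c\<in>Basis - {k}. y c *\<^sub>R c) \<bullet> b = (\<Sum>c\<in>Basis - {k}. if c = b then y b else 0)"
      unfolding inner_sum_left using that by (intro sum.cong) (auto simp: inner_Basis)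
    then show ?thesis using that k by (auto simp: inner_add_left inner_diff_left inner_Basis)
  qed
  have "(norm ?z)\<^sup>2 = (\<Sum>b\<in>Basis. (?z \<bullet> b)\<^sup>2)"
    unfolding power2_norm_eq_inner by (subst euclidean_inner) (simp add: power2_eq_square)
  also have "\<dots> = (\<Sum>b\<in>Basis. (if b = k then s - t else y b)\<^sup>2)" using z by simp
  also have "\<dots> = (s - t)\<^sup>2 + (\<Sum>b\<in>Basis - {k}. (y b)\<^sup>2)"
    using k by (subst sum.remove[of _ k]) (auto intro!: sum.cong)
  finally show ?thesis .
qed

lemma shifted_gaussian_eq_section_mass:
  fixes B :: "'a::euclidean_space set"
  assumes [measurable]: "B \<in> sets borel" and k: "k \<in> Basis"
  shows "(\<integral>\<^sup>+z. indicator B z * ennreal (exp (- (norm (z - t *\<^sub>R k))\<^sup>2 / 2)) \<partial>lborel)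
    = (\<integral>\<^sup>+s. section_mass B k s * ennreal (exp (- (s - t)\<^sup>2 / 2)) \<partial>lborel)"
proof -
  let ?pt = "\<lambda>s y. s *\<^sub>R k + (\<Sum>b\<in>Basis - {k}. y b *\<^sub>R b)"
  have e: "indicator B (?pt s y) * ennreal (exp (- (norm (?pt s y - t *\<^sub>R k))\<^sup>2 / 2))
    = indicator B (?pt s y) * ennreal (exp (- (\<Sum>b\<in>Basis - {k}. (y b)\<^sup>2) / 2)) * ennreal (exp (- (s - t)\<^sup>2 / 2))"
    for s and y :: "'a \<Rightarrow> real"
  proof -
    have "exp (- (norm (?pt s y - t *\<^sub>R k))\<^sup>2 / 2)
      = exp (- (\<Sum>b\<in>Basis - {k}. (y b)\<^sup>2) / 2) * exp (- (s - t)\<^sup>2 / 2)"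
      unfolding norm_shifted_split[OF k] by (simp add: exp_add[symmetric] field_simps)
    then show ?thesis by (simp only: ennreal_mult[OF exp_ge_zero exp_ge_zero] mult.assoc)
  qed
  have "(\<integral>\<^sup>+z. indicator B z * ennreal (exp (- (norm (z - t *\<^sub>R k))\<^sup>2 / 2)) \<partial>lborel)
    = (\<integral>\<^sup>+s. \<integral>\<^sup>+y. indicator B (?pt s y) * ennreal (exp (- (norm (?pt s y - t *\<^sub>R k))\<^sup>2 / 2))
        \<partial>(\<Pi>\<^sub>M b\<in>Basis - {k}. lborel) \<partial>lborel)"
    by (rule nn_integral_lborel_split[OF _ k]) measurable
  also have "\<dots> = (\<integral>\<^sup>+s. section_mass B k s * ennreal (exp (- (s - t)\<^sup>2 / 2)) \<partial>lborel)"
    unfolding e section_mass_def by (intro nn_integral_cong nn_integral_multc) measurable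
  finally show ?thesis .
qed

lemma section_mass_uminus:
  fixes B :: "'a::euclidean_space set"
  assumes [measurable]: "B \<in> sets borel" and sym: "\<And>z. - z \<in> B \<longleftrightarrow> z \<in> B"
  shows "section_mass B k (- s) = section_mass B k s"
proof -
  let ?J = "Basis - {k}"
  let ?F = "\<lambda>y. indicator B (s *\<^sub>R k + (\<Sum>b\<in>?J. y b *\<^sub>R b)) * ennreal (exp (- (\<Sum>b\<in>?J. (y b)\<^sup>2) / 2))"
  have "section_mass B k (- s) = (\<integral>\<^sup>+y. ?F (\<lambda>b\<in>?J. - y b) \<partial>(\<Pi>\<^sub>M b\<in>?J. lborel))"
    unfolding section_mass_def
  proof (rule nn_integral_cong)
    fix y :: "'a \<Rightarrow> real"
    let ?w = "- s *\<^sub>R k + (\<Sum>b\<in>?J. y b *\<^sub>R b)"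
    have "- ?w = s *\<^sub>R k + (\<Sum>b\<in>?J. (\<lambda>b\<in>?J. - y b) b *\<^sub>R b)"
      by (simp add: sum_negf[symmetric])
    then have "s *\<^sub>R k + (\<Sum>b\<in>?J. (\<lambda>b\<in>?J. - y b) b *\<^sub>R b) \<in> B \<longleftrightarrow> ?w \<in> B"
      using sym[of ?w] by (simp only:)
    then have "indicator B ?w = (indicator B (s *\<^sub>R k + (\<Sum>b\<in>?J. (\<lambda>b\<in>?J. - y b) b *\<^sub>R b)) :: ennreal)"
      unfolding indicator_def by (simp only:)
    moreover have "(\<Sum>b\<in>?J. (y b)\<^sup>2) = (\<Sum>b\<in>?J. ((\<lambda>b\<in>?J. - y b) b)\<^sup>2)"
      by (intro sum.cong) auto
    ultimately show "indicator B ?w * ennreal (exp (- (\<Sum>b\<in>?J. (y b)\<^sup>2) / 2)) = ?F (\<lambda>b\<in>?J. - y b)"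
      by (simp only:)
  qed
  also have "\<dots> = section_mass B k s"
    unfolding section_mass_def by (rule nn_integral_PiM_lborel_uminus) auto
  finally show ?thesis .
qed

text \<open>
  For \<open>\<bar>s\<bar> < \<bar>r\<bar>\<close> the height \<open>s\<close> is a convex combination of \<open>r\<close> and \<open>-r\<close>, so by convexity the combinations of
  the slices at \<open>r\<close> and \<open>-r\<close> lie in the slice at \<open>s\<close>. By Prekopa-Leindler the mass at \<open>s\<close> dominates a
  geometric mean of the masses at \<open>r\<close> and \<open>-r\<close>, and these two are equal by symmetry.
\<close>

lemma section_mass_unimodal:
  fixes B :: "'a::euclidean_space set"
  assumes [measurable]: "B \<in> sets borel" and B: "convex B" and sym: "\<And>z. - z \<in> B \<longleftrightarrow> z \<in> B"
    and sr: "\<bar>s\<bar> \<le> \<bar>r\<bar>"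
  shows "section_mass B k r \<le> section_mass B k s"
proof (cases "s = r \<or> s = - r")
  case True
  then show ?thesis using section_mass_uminus[OF assms(1) sym, where k=k] by auto
next
  case False
  then have r: "r \<noteq> 0" using sr by auto
  \<comment> \<open>The weight for which \<open>s\<close> is the combination of \<open>r\<close> and \<open>-r\<close>.\<close>
  define l where "l = (1 - s / r) / 2"
  have "\<bar>s\<bar> < \<bar>r\<bar>" using False sr by (auto simp: abs_if split: if_splits)
  then have "\<bar>s / r\<bar> < 1" using r by simp
  then have "s / r < 1" "- 1 < s / r" by (simp_all only: abs_less_iff) auto
  then have l: "0 < l" "l < 1" unfolding l_def by simp_all
  have s: "s = (1 - l) * r + l * (- r)" unfolding l_def using r by (simp add: field_simps)
  let ?J = "Basis - {k}"
  let ?pt = "\<lambda>s y. s *\<^sub>R k + (\<Sum>b\<in>?J. y b *\<^sub>R b)"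
  let ?q = "\<lambda>y. \<Sum>b\<in>?J. (y b)\<^sup>2"
  have pt: "?pt s (\<lambda>b. (1 - l) * x b + l * y b) = (1 - l) *\<^sub>R ?pt r x + l *\<^sub>R ?pt (- r) y" for x y :: "'a \<Rightarrow> real"
  proof -
    have "(\<Sum>b\<in>?J. ((1 - l) * x b + l * y b) *\<^sub>R b)
        = (1 - l) *\<^sub>R (\<Sum>b\<in>?J. x b *\<^sub>R b) + l *\<^sub>R (\<Sum>b\<in>?J. y b *\<^sub>R b)"
      by (simp add: scaleR_sum_right sum.distrib scaleR_add_left)
    moreover have "s *\<^sub>R k = (1 - l) *\<^sub>R (r *\<^sub>R k) + l *\<^sub>R ((- r) *\<^sub>R k)"
      by (subst s) (simp only: scaleR_add_left scaleR_scaleR)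
    ultimately show ?thesis by (simp only: scaleR_add_right add_ac)
  qed
  have q: "?q (\<lambda>b. (1 - l) * x b + l * y b) \<le> (1 - l) * ?q x + l * ?q y" for x y :: "'a \<Rightarrow> real"
    unfolding sum_distrib_left sum.distrib[symmetric]
  proof (rule sum_mono)
    fix b
    have "0 \<le> l * (1 - l) * (x b - y b)\<^sup>2" using l by simp
    then show "((1 - l) * x b + l * y b)\<^sup>2 \<le> (1 - l) * (x b)\<^sup>2 + l * (y b)\<^sup>2"
      by (simp add: power2_eq_square algebra_simps)
  qed
  have less: "z \<in> B \<and> p < e" if "ennreal p < indicator B z * ennreal e" "0 < p" for z p e
    using that by (cases "z \<in> B") (auto simp: ennreal_less_iff)
  have "geom_mean_le l (section_mass B k r) (section_mass B k (- r)) (section_mass B k s)"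
    unfolding section_mass_def
  proof (rule Prekopa_Leindler_PiM[OF _ l])
    fix x y :: "'a \<Rightarrow> real"
    show "geom_mean_le l (indicator B (?pt r x) * ennreal (exp (- ?q x / 2)))
      (indicator B (?pt (- r) y) * ennreal (exp (- ?q y / 2)))
      (indicator B (?pt s (\<lambda>b. (1 - l) * x b + l * y b)) * ennreal (exp (- ?q (\<lambda>b. (1 - l) * x b + l * y b) / 2)))"
      unfolding geom_mean_le_def
    proof (intro allI impI)
      fix p q' :: real
      assume pq: "0 < p" "0 < q'" and p: "ennreal p < indicator B (?pt r x) * ennreal (exp (- ?q x / 2))"
        and q': "ennreal q' < indicator B (?pt (- r) y) * ennreal (exp (- ?q y / 2))"
      have xB: "?pt r x \<in> B" and pe: "p < exp (- ?q x / 2)"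
        using less[OF p pq(1)] by auto
      have yB: "?pt (- r) y \<in> B" and qe: "q' < exp (- ?q y / 2)"
        using less[OF q' pq(2)] by auto
      have "?pt s (\<lambda>b. (1 - l) * x b + l * y b) \<in> B"
        unfolding pt using l by (intro convexD[OF B xB yB]) auto
      moreover have "p powr (1 - l) * q' powr l \<le> exp (- ?q (\<lambda>b. (1 - l) * x b + l * y b) / 2)"
      proof -
        have "p powr (1 - l) * q' powr l \<le> exp (- ?q x / 2) powr (1 - l) * exp (- ?q y / 2) powr l"
          using pq pe qe l by (intro mult_mono powr_mono2) auto
        also have "\<dots> = exp (- ((1 - l) * ?q x + l * ?q y) / 2)"
          by (simp add: powr_def exp_add[symmetric] field_simps)
        also have "\<dots> \<le> exp (- ?q (\<lambda>b. (1 - l) * x b + l * y b) / 2)"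
          using q[of x y] by simp
        finally show ?thesis .
      qed
      ultimately show "ennreal (p powr (1 - l) * q' powr l)
        \<le> indicator B (?pt s (\<lambda>b. (1 - l) * x b + l * y b)) * ennreal (exp (- ?q (\<lambda>b. (1 - l) * x b + l * y b) / 2))"
        by (simp add: ennreal_leI)
    qed
  qed auto
  then show ?thesis
    unfolding section_mass_uminus[OF assms(1) sym] by (rule geom_mean_le_self)
qed

text \<open>
  This is where \<open>B\<close> is replaced by a symmetric set \<open>I\<close> that contains its heights: the slice masses are
  unimodal and vanish outside \<open>I\<close>.
\<close>

lemma shifted_gaussian_symmetric_convex_le:
  fixes B :: "'a::euclidean_space set"
  assumes [measurable]: "B \<in> sets borel" "I \<in> sets borel" and B: "convex B" and sym: "\<And>z. - z \<in> B \<longleftrightarrow> z \<in> B"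
    and k: "k \<in> Basis" and I: "\<And>s. - s \<in> I \<longleftrightarrow> s \<in> I" and BI: "\<And>z. z \<in> B \<Longrightarrow> z \<bullet> k \<in> I"
  shows "(\<integral>\<^sup>+z. indicator B z * ennreal (exp (- (norm (z - t *\<^sub>R k))\<^sup>2 / 2)) \<partial>lborel)
      * (\<integral>\<^sup>+s. indicator I s * ennreal (exp (- s\<^sup>2 / 2)) \<partial>lborel)
    \<le> (\<integral>\<^sup>+s. indicator I s * ennreal (exp (- (s - t)\<^sup>2 / 2)) \<partial>lborel)
      * (\<integral>\<^sup>+z. indicator B z * ennreal (exp (- (norm z)\<^sup>2 / 2)) \<partial>lborel)"
proof -
  have supp: "section_mass B k s * indicator I s = section_mass B k s" for s
  proof (cases "s \<in> I")
    case False
    have "s *\<^sub>R k + (\<Sum>b\<in>Basis - {k}. y b *\<^sub>R b) \<notin> B" for y :: "'a \<Rightarrow> real"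
    proof
      have "(\<Sum>b\<in>Basis - {k}. y b *\<^sub>R b) \<bullet> k = 0"
        unfolding inner_sum_left using k by (intro sum.neutral) (auto simp: inner_Basis)
      then have "(s *\<^sub>R k + (\<Sum>b\<in>Basis - {k}. y b *\<^sub>R b)) \<bullet> k = s"
        using k by (simp add: inner_add_left)
      moreover assume "s *\<^sub>R k + (\<Sum>b\<in>Basis - {k}. y b *\<^sub>R b) \<in> B"
      ultimately show False using BI False by metis
    qed
    then have "section_mass B k s = 0" unfolding section_mass_def by simp
    then show ?thesis by simp
  qed simp
  have "(\<integral>\<^sup>+s. section_mass B k s * indicator I s * ennreal (exp (- (s - t)\<^sup>2 / 2)) \<partial>lborel)
      * (\<integral>\<^sup>+s. indicator I s * ennreal (exp (- s\<^sup>2 / 2)) \<partial>lborel)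
    \<le> (\<integral>\<^sup>+s. indicator I s * ennreal (exp (- (s - t)\<^sup>2 / 2)) \<partial>lborel)
      * (\<integral>\<^sup>+s. section_mass B k s * indicator I s * ennreal (exp (- s\<^sup>2 / 2)) \<partial>lborel)"
    by (rule shifted_gaussian_unimodal_le) (use section_mass_unimodal[OF assms(1) B sym] I in auto)
  then show ?thesis
    using shifted_gaussian_eq_section_mass[OF assms(1) k, of t] shifted_gaussian_eq_section_mass[OF assms(1) k, of 0]
    by (simp add: supp)
qed

text \<open>
  The masses of slices are even, so the shift multiplies the centred integrand by
  \<open>exp (- t\<^sup>2 / 2) * cosh (t * s)\<close>, and \<open>cosh \<ge> 1\<close>.
\<close>

lemma shifted_gaussian_symmetric_ge:
  fixes B :: "'a::euclidean_space set"
  assumes [measurable]: "B \<in> sets borel" and sym: "\<And>z. - z \<in> B \<longleftrightarrow> z \<in> B" and k: "k \<in> Basis"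
  shows "ennreal (exp (- t\<^sup>2 / 2)) * (\<integral>\<^sup>+z. indicator B z * ennreal (exp (- (norm z)\<^sup>2 / 2)) \<partial>lborel)
    \<le> (\<integral>\<^sup>+z. indicator B z * ennreal (exp (- (norm (z - t *\<^sub>R k))\<^sup>2 / 2)) \<partial>lborel)"
proof -
  have "ennreal (exp (- t\<^sup>2 / 2)) * (\<integral>\<^sup>+z. indicator B z * ennreal (exp (- (norm z)\<^sup>2 / 2)) \<partial>lborel)
     = (\<integral>\<^sup>+s. ennreal (exp (- t\<^sup>2 / 2)) * (section_mass B k s * ennreal (exp (- s\<^sup>2 / 2))) \<partial>lborel)"
    using shifted_gaussian_eq_section_mass[OF assms(1) k, of 0] by (simp add: nn_integral_cmult)
  also have "\<dots> \<le> (\<integral>\<^sup>+s. section_mass B k s * ennreal (exp (- t\<^sup>2 / 2) * cosh (t * s)) * ennreal (exp (- s\<^sup>2 / 2)) \<partial>lborel)"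
  proof (rule nn_integral_mono)
    fix s
    have "ennreal (exp (- t\<^sup>2 / 2)) \<le> ennreal (exp (- t\<^sup>2 / 2) * cosh (t * s))"
      by (intro ennreal_leI) (simp add: cosh_real_ge_1)
    then have "ennreal (exp (- t\<^sup>2 / 2)) * (section_mass B k s * ennreal (exp (- s\<^sup>2 / 2)))
      \<le> ennreal (exp (- t\<^sup>2 / 2) * cosh (t * s)) * (section_mass B k s * ennreal (exp (- s\<^sup>2 / 2)))"
      by (rule mult_right_mono) simp
    also have "\<dots> = section_mass B k s * ennreal (exp (- t\<^sup>2 / 2) * cosh (t * s)) * ennreal (exp (- s\<^sup>2 / 2))"
      by (simp only: mult_ac)
    finally show "ennreal (exp (- t\<^sup>2 / 2)) * (section_mass B k s * ennreal (exp (- s\<^sup>2 / 2)))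
      \<le> section_mass B k s * ennreal (exp (- t\<^sup>2 / 2) * cosh (t * s)) * ennreal (exp (- s\<^sup>2 / 2))" .
  qed
  also have "\<dots> = (\<integral>\<^sup>+s. section_mass B k s * ennreal (exp (- (s - t)\<^sup>2 / 2)) \<partial>lborel)"
    by (rule nn_integral_even_shifted_gaussian[symmetric]) (use section_mass_uminus[OF assms(1) sym] in auto)
  also have "\<dots> = (\<integral>\<^sup>+z. indicator B z * ennreal (exp (- (norm (z - t *\<^sub>R k))\<^sup>2 / 2)) \<partial>lborel)"
    by (rule shifted_gaussian_eq_section_mass[OF assms(1) k, symmetric])
  finally show ?thesis .
qed

section \<open>Square roots of positive definite matrices\<close>

lemma quadratic_nonneg_imp_linear_coeff_zero:
  fixes a b :: real
  assumes "\<And>t. 0 \<le> 2 * t * a + t\<^sup>2 * b"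
  shows "a = 0"
proof (rule ccontr)
  assume "a \<noteq> 0"
  define d where "d = \<bar>b\<bar> + 1"
  define t where "t = - a / d"
  have d: "0 < d" "b \<le> d" unfolding d_def by auto
  have dt: "d * t = - a" unfolding t_def using d by simp
  have "t\<^sup>2 * b \<le> t\<^sup>2 * d" using d by (intro mult_left_mono) auto
  also have "t\<^sup>2 * d = t * (d * t)" by (simp add: power2_eq_square)
  also have "\<dots> = - (t * a)" by (simp add: dt)
  finally have "t\<^sup>2 * b \<le> - (t * a)" .
  moreover have "2 * t * a = t * a + t * a" by simp
  ultimately have "2 * t * a + t\<^sup>2 * b \<le> t * a" by linarith
  also have "t * a = - (a * a / d)" unfolding t_def by simp
  also have "\<dots> < 0" using d \<open>a \<noteq> 0\<close> by (simp add: zero_less_mult_iff less_le)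
  finally show False using assms[of t] by simp
qed

text \<open>
  A maximiser \<open>x\<close> of the Rayleigh quotient on the unit sphere of \<open>V\<close>, with maximum \<open>c\<close>, is an eigenvector:
  the form \<open>c * (y \<bullet> y) - y \<bullet> f y\<close> is nonnegative on \<open>V\<close> and vanishes at \<open>x\<close>, so its derivative at \<open>x\<close> in the
  direction \<open>w = c *\<^sub>R x - f x\<close>, which is twice \<open>w \<bullet> w\<close>, must vanish.
\<close>

lemma self_adjoint_eigenvector_exists:
  fixes f :: "'a::euclidean_space \<Rightarrow> 'a"
  assumes f: "linear f" and sym: "\<And>x y. x \<bullet> f y = f x \<bullet> y"
    and V: "subspace V" "f ` V \<subseteq> V" "V \<noteq> {0}"
  shows "\<exists>x\<in>V. \<exists>c. norm x = 1 \<and> f x = c *\<^sub>R x"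
proof -
  obtain v where v: "v \<in> V" "v \<noteq> 0" using V subspace_0 by blast
  have "compact (sphere 0 1 \<inter> V)"
    by (intro compact_Int_closed closed_subspace V compact_sphere)
  moreover have "v /\<^sub>R norm v \<in> sphere 0 1 \<inter> V"
    using v V by (simp add: subspace_scale)
  moreover have "continuous_on (sphere 0 1 \<inter> V) (\<lambda>x. x \<bullet> f x)"
    by (intro continuous_on_inner continuous_on_id linear_continuous_on linear_conv_bounded_linear[THEN iffD1] f)
  ultimately obtain x where x: "x \<in> sphere 0 1 \<inter> V" and max: "\<And>y. y \<in> sphere 0 1 \<inter> V \<Longrightarrow> y \<bullet> f y \<le> x \<bullet> f x"
    using continuous_attains_sup[of "sphere 0 1 \<inter> V" "\<lambda>x. x \<bullet> f x"] by blast
  define c where "c = x \<bullet> f x"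
  have nx: "norm x = 1" "x \<in> V" using x by auto
  have le: "y \<bullet> f y \<le> c * (y \<bullet> y)" if "y \<in> V" for y
  proof (cases "y = 0")
    case True then show ?thesis using linear_0[OF f] by simp
  next
    case False
    have "(y /\<^sub>R norm y) \<bullet> f (y /\<^sub>R norm y) \<le> c"
      unfolding c_def using False that V by (intro max) (simp add: subspace_scale)
    then have "(y \<bullet> f y) / (norm y)\<^sup>2 \<le> c"
      by (simp add: linear_cmul[OF f] power2_eq_square field_simps)
    then show ?thesis using False by (simp add: field_simps dot_square_norm)
  qed
  define w where "w = c *\<^sub>R x - f x"
  have w: "w \<in> V" unfolding w_def using nx V by (intro subspace_diff subspace_scale) auto
  define b where "b = c * (w \<bullet> w) - w \<bullet> f w"
  have key: "0 \<le> 2 * t * (w \<bullet> w) + t\<^sup>2 * b" for t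
  proof -
    have "(x + t *\<^sub>R w) \<bullet> f (x + t *\<^sub>R w) \<le> c * ((x + t *\<^sub>R w) \<bullet> (x + t *\<^sub>R w))"
      by (intro le subspace_add subspace_scale V nx w)
    moreover have "(x + t *\<^sub>R w) \<bullet> f (x + t *\<^sub>R w) = c + 2 * t * (w \<bullet> f x) + t\<^sup>2 * (w \<bullet> f w)"
      using sym[of x w] by (simp add: c_def linear_add[OF f] linear_cmul[OF f] inner_add_left inner_add_right power2_eq_square algebra_simps inner_commute)
    moreover have "(x + t *\<^sub>R w) \<bullet> (x + t *\<^sub>R w) = 1 + 2 * t * (w \<bullet> x) + t\<^sup>2 * (w \<bullet> w)"
      using nx by (simp add: inner_add_left inner_add_right power2_eq_square algebra_simps inner_commute norm_eq_1)
    moreover have "w \<bullet> w = c * (w \<bullet> x) - w \<bullet> f x"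
      by (subst (2) w_def) (simp add: inner_diff_right)
    ultimately have "c + 2 * t * (w \<bullet> f x) + t\<^sup>2 * (w \<bullet> f w) \<le> c * (1 + 2 * t * (w \<bullet> x) + t\<^sup>2 * (w \<bullet> w))"
      and ww: "w \<bullet> w = c * (w \<bullet> x) - w \<bullet> f x" by simp_all
    moreover have "2 * t * (w \<bullet> w) = 2 * t * (c * (w \<bullet> x) - w \<bullet> f x)" by (simp only: ww)
    moreover have "c * (1 + 2 * t * (w \<bullet> x) + t\<^sup>2 * (w \<bullet> w)) - (c + 2 * t * (w \<bullet> f x) + t\<^sup>2 * (w \<bullet> f w))
        = 2 * t * (c * (w \<bullet> x) - w \<bullet> f x) + t\<^sup>2 * b"
      by (simp add: b_def algebra_simps)
    ultimately show ?thesis by linarith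
  qed
  then have "w \<bullet> w = 0" by (rule quadratic_nonneg_imp_linear_coeff_zero)
  then have "f x = c *\<^sub>R x" by (simp add: w_def)
  then show ?thesis using nx by blast
qed

text \<open>
  Induction on the dimension of \<open>V\<close>: the orthogonal complement in \<open>V\<close> of an eigenvector is invariant again.
\<close>

lemma self_adjoint_orthonormal_eigenbasis:
  fixes f :: "'a::euclidean_space \<Rightarrow> 'a"
  assumes f: "linear f" and sym: "\<And>x y. x \<bullet> f y = f x \<bullet> y"
    and V: "subspace V" "f ` V \<subseteq> V"
  shows "\<exists>E. finite E \<and> E \<subseteq> V \<and> V \<subseteq> span E \<and> pairwise orthogonal E \<and> (\<forall>e\<in>E. norm e = 1 \<and> (\<exists>c. f e = c *\<^sub>R e))"
  using V
proof (induction "dim V" arbitrary: V rule: less_induct)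
  case less
  show ?case
  proof (cases "V = {0}")
    case True
    then show ?thesis by (intro exI[of _ "{}"]) auto
  next
    case False
    obtain x c where x: "x \<in> V" "norm x = 1" "f x = c *\<^sub>R x"
      using self_adjoint_eigenvector_exists[OF f sym less.prems False] by blast
    define W where "W = V \<inter> {y. x \<bullet> y = 0}"
    have W: "subspace W" unfolding W_def
      by (intro subspace_inter less.prems subspace_hyperplane)
    moreover have "f ` W \<subseteq> W"
      unfolding W_def using less.prems sym[of x] x by (auto simp: inner_commute)
    moreover have "W \<subset> V"
      unfolding W_def using x by (force simp: norm_eq_1)
    then have "dim W < dim V"
      using W less.prems(1) by (metis dim_subset dim_psubset span_eq_iff)
    ultimately obtain E where E: "finite E" "E \<subseteq> W" "W \<subseteq> span E" "pairwise orthogonal E"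
        "\<forall>e\<in>E. norm e = 1 \<and> (\<exists>c. f e = c *\<^sub>R e)"
      using less.hyps[of W] by blast
    have "y \<in> span (insert x E)" if "y \<in> V" for y
    proof -
      have "y - (x \<bullet> y) *\<^sub>R x \<in> W"
        unfolding W_def using that x less.prems by (auto simp: inner_diff_right norm_eq_1 intro: subspace_diff subspace_scale)
      then have "y - (x \<bullet> y) *\<^sub>R x \<in> span E" using E by blast
      then show ?thesis using span_breakdown_eq by blast
    qed
    then show ?thesis
      using E x unfolding W_def
      by (intro exI[of _ "insert x E"]) (auto simp: pairwise_insert orthogonal_def inner_commute)
  qed
qed

lemma symmetric_matrix_inner:
  fixes S :: "real^'n^'n"
  shows "transpose S = S \<longleftrightarrow> (\<forall>x y. x \<bullet> (S *v y) = (S *v x) \<bullet> y)"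
proof
  assume "transpose S = S"
  then show "\<forall>x y. x \<bullet> (S *v y) = (S *v x) \<bullet> y"
    by (metis dot_lmul_matrix transpose_matrix_vector)
next
  assume *: "\<forall>x y. x \<bullet> (S *v y) = (S *v x) \<bullet> y"
  have "(transpose S *v x) \<bullet> y = (S *v x) \<bullet> y" for x y
    using * by (metis dot_lmul_matrix transpose_matrix_vector)
  then have "transpose S *v x = S *v x" for x
    by (metis vector_eq_rdot)
  then show "transpose S = S" by (simp add: matrix_eq)
qed

text \<open>
  If the nonnegative form vanishes at \<open>x\<close>, its derivative at \<open>x\<close> in the direction \<open>S *v x\<close> vanishes too,
  which gives \<open>S *v x = 0\<close>.
\<close>

lemma invertible_pos_semidef_imp_pos_def:
  fixes S :: "real^'n^'n"
  assumes "pos_semidef_mat S" "invertible S"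
  shows "pos_def_mat S"
proof -
  have sym: "x \<bullet> (S *v y) = (S *v x) \<bullet> y" and nn: "0 \<le> x \<bullet> (S *v x)" for x y
    using assms(1) unfolding pos_semidef_mat_def symmetric_matrix_inner by blast+
  have "0 < x \<bullet> (S *v x)" if "x \<noteq> 0" for x
  proof (rule ccontr)
    assume "\<not> 0 < x \<bullet> (S *v x)"
    then have x0: "x \<bullet> (S *v x) = 0" using nn[of x] by simp
    define w where "w = S *v x"
    have w: "w \<noteq> 0"
      unfolding w_def using assms(2) that by (metis invertible_def matrix_vector_mul_assoc matrix_vector_mul_lid matrix_vector_mult_0_right)
    have wS: "x \<bullet> (S *v w) = w \<bullet> w" using sym[of x w] by (simp add: w_def)
    define b where "b = w \<bullet> (S *v w)"
    have "(x + t *\<^sub>R w) \<bullet> (S *v (x + t *\<^sub>R w)) = 2 * t * (w \<bullet> w) + t\<^sup>2 * b" for t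
      using x0 wS
      by (simp add: b_def matrix_vector_right_distrib matrix_vector_mult_scaleR inner_add_left inner_add_right power2_eq_square algebra_simps w_def)
    then have "0 \<le> 2 * t * (w \<bullet> w) + t\<^sup>2 * b" for t using nn[of "x + t *\<^sub>R w"] by simp
    then have "w \<bullet> w = 0" by (rule quadratic_nonneg_imp_linear_coeff_zero)
    then show False using w by simp
  qed
  then show ?thesis using assms(1) by (simp add: pos_def_mat_def pos_semidef_mat_def)
qed

text \<open>
  The root acts on an orthonormal eigenbasis of \<open>S\<close> by the roots of the eigenvalues. For uniqueness, let \<open>Q\<close>
  be a positive definite root and \<open>e\<close> an eigenvector of \<open>S\<close> with eigenvalue \<open>c\<close>. Then
  \<open>w = Q e - sqrt c e\<close> satisfies \<open>Q w = - sqrt c w\<close>, which forces \<open>w = 0\<close> as \<open>Q\<close> is positive definite.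
\<close>

lemma ex1_pos_def_sqrt:
  fixes S :: "real^'n^'n"
  assumes S: "pos_def_mat S"
  shows "\<exists>!R. pos_def_mat R \<and> R ** R = S"
proof -
  have sym: "x \<bullet> (S *v y) = (S *v x) \<bullet> y" for x y
    using S unfolding pos_def_mat_def symmetric_matrix_inner by blast
  obtain E where E: "finite E" "span E = UNIV" "pairwise orthogonal E" "\<And>e. e \<in> E \<Longrightarrow> norm e = 1"
      and ev: "\<forall>e\<in>E. \<exists>c. S *v e = c *\<^sub>R e"
    using self_adjoint_orthonormal_eigenbasis[of "(*v) S" UNIV] sym by (auto simp: top_unique)
  from ev obtain c where c: "\<And>e. e \<in> E \<Longrightarrow> S *v e = c e *\<^sub>R e" by metis
  have c_pos: "0 < c e" if "e \<in> E" for e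
  proof -
    have "e \<noteq> 0" using E(4)[OF that] by auto
    then have "0 < e \<bullet> (S *v e)" using S by (simp add: pos_def_mat_def)
    then show ?thesis using c[OF that] E(4)[OF that] by (simp add: norm_eq_1)
  qed
  have expand: "(\<Sum>e\<in>E. (e \<bullet> x) *\<^sub>R e) = x" for x
    using E orthonormal_basis_expand[of E x] by (simp add: inner_commute)
  have ortho: "e \<bullet> e' = (if e = e' then 1 else 0)" if "e \<in> E" "e' \<in> E" for e e'
    using that E by (auto simp: norm_eq_1 pairwise_def orthogonal_def)
  have eqI: "A = B" if "\<And>e. e \<in> E \<Longrightarrow> A *v e = B *v e" for A B :: "real^'n^'n"
  proof -
    have "A *v x = B *v x" for x
      using linear_eq_on_span[of "(*v) A" "(*v) B" E x] that E(2) by auto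
    then show ?thesis by (simp add: matrix_eq)
  qed
  define r where "r x = (\<Sum>e\<in>E. (sqrt (c e) * (e \<bullet> x)) *\<^sub>R e)" for x
  have "linear r" unfolding r_def
    by (intro linearI) (simp_all add: inner_add_right algebra_simps sum.distrib scaleR_sum_right)
  define R where "R = matrix r"
  have R: "R *v x = r x" for x unfolding R_def using \<open>linear r\<close> by (simp add: matrix_works)
  have re: "R *v e = sqrt (c e) *\<^sub>R e" if "e \<in> E" for e
  proof -
    have "r e = (\<Sum>e'\<in>E. if e' = e then sqrt (c e) *\<^sub>R e else 0)"
      unfolding r_def using that by (intro sum.cong) (auto simp: ortho)
    then show ?thesis using that E(1) by (simp add: R)
  qed
  have rr: "x \<bullet> (R *v y) = (\<Sum>e\<in>E. sqrt (c e) * (e \<bullet> x) * (e \<bullet> y))" for x y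
    unfolding R r_def by (simp add: inner_sum_right inner_commute mult_ac)
  have "pos_def_mat R"
    unfolding pos_def_mat_def symmetric_matrix_inner
  proof (intro conjI allI impI)
    show "x \<bullet> (R *v y) = (R *v x) \<bullet> y" for x y
      using rr[of x y] rr[of y x] by (simp add: inner_commute mult_ac)
    fix x :: "real^'n" assume "x \<noteq> 0"
    have "\<exists>e\<in>E. e \<bullet> x \<noteq> 0"
    proof (rule ccontr)
      assume "\<not> ?thesis"
      then have "(\<Sum>e\<in>E. (e \<bullet> x) *\<^sub>R e) = 0" by (intro sum.neutral) simp
      with expand[of x] \<open>x \<noteq> 0\<close> show False by simp
    qed
    then obtain e where "e \<in> E" "e \<bullet> x \<noteq> 0" by blast
    then show "0 < x \<bullet> (R *v x)"
      unfolding rr using E(1) c_pos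
      by (intro sum_pos2[of _ e]) (auto simp: mult.assoc less_le zero_less_mult_iff)
  qed
  moreover have "R ** R = S"
  proof (rule eqI)
    fix e assume e: "e \<in> E"
    then show "R ** R *v e = S *v e"
      using c_pos[OF e] by (simp add: matrix_vector_mul_assoc[symmetric] re matrix_vector_mult_scaleR c)
  qed
  moreover have "Q = R" if Q: "pos_def_mat Q" "Q ** Q = S" for Q
  proof (rule eqI)
    fix e assume e: "e \<in> E"
    define w where "w = Q *v e - sqrt (c e) *\<^sub>R e"
    have "Q *v w = - (sqrt (c e) *\<^sub>R w)"
      using c_pos[OF e] c[OF e] unfolding w_def Q(2)[symmetric]
      by (simp add: matrix_vector_mult_diff_distrib matrix_vector_mult_scaleR matrix_vector_mul_assoc scaleR_diff_right)
    then have "w \<bullet> (Q *v w) = - (sqrt (c e) * (w \<bullet> w))" by simp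
    moreover have "0 \<le> sqrt (c e) * (w \<bullet> w)" using c_pos[OF e] by simp
    ultimately have "w = 0" using Q(1) unfolding pos_def_mat_def by (metis neg_le_0_iff_le not_le)
    then show "Q *v e = R *v e" using re[OF e] by (simp add: w_def)
  qed
  ultimately show ?thesis by blast
qed

text \<open>
  The inverse square root turns the quadratic form of the inverse covariance matrix into the Euclidean
  one, and a rotation then moves the image of \<open>u\<close> onto a given axis.
\<close>

lemma whitening_map_exists:
  fixes S :: "real^'n^'n" and u k :: "real^'n"
  assumes S: "pos_def_mat S" and u: "u \<noteq> 0" and k: "norm k = 1"
  shows "0 < norm (inv_sqrt_mat S *v u)"
    and "\<exists>T. linear T \<and> bij T \<and> (\<forall>x y. T x \<bullet> T y = x \<bullet> (matrix_inv S *v y)) \<and> T u = norm (inv_sqrt_mat S *v u) *\<^sub>R k"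
proof -
  define R where "R = sqrt_mat S"
  define W where "W = inv_sqrt_mat S"
  have R: "pos_def_mat R" "R ** R = S"
    using theI'[OF ex1_pos_def_sqrt[OF S]] by (simp_all add: R_def sqrt_mat_def)
  have "inj ((*v) R)"
  proof (rule linear_injective_0[THEN iffD2], simp, intro allI impI)
    fix x assume "R *v x = 0"
    then show "x = 0" using R(1) unfolding pos_def_mat_def by (metis inner_zero_right less_irrefl)
  qed
  then have "invertible R"
    by (metis invertible_left_inverse matrix_left_invertible_injective)
  then have W: "R ** W = mat 1" "W ** R = mat 1"
    unfolding W_def inv_sqrt_mat_def R_def[symmetric] invertible_def matrix_inv_def by (metis (mono_tags, lifting) someI_ex)+
  have SWW: "S ** (W ** W) = mat 1" and WWS: "(W ** W) ** S = mat 1"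
    unfolding R(2)[symmetric] by (metis W matrix_mul_assoc matrix_mul_lid)+
  from SWW WWS have S_inv: "S ** matrix_inv S = mat 1"
    unfolding matrix_inv_def by (rule someI2[where a="W ** W", OF conjI]) simp
  have "W ** W = (W ** W) ** (S ** matrix_inv S)" unfolding S_inv by simp
  also have "\<dots> = ((W ** W) ** S) ** matrix_inv S" by (simp only: matrix_mul_assoc)
  also have "\<dots> = matrix_inv S" unfolding WWS by simp
  finally have WW: "W ** W = matrix_inv S" .
  have "transpose W = W"
  proof -
    have "transpose W ** R = mat 1"
      using W R(1) unfolding pos_def_mat_def by (metis matrix_transpose_mul transpose_mat)
    then show ?thesis using W by (metis matrix_mul_assoc matrix_mul_lid matrix_mul_rid)
  qed
  then have Wsym: "(W *v x) \<bullet> y = x \<bullet> (W *v y)" for x y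
    using symmetric_matrix_inner[of W] by simp
  have Winj: "inj ((*v) W)"
    using W by (metis matrix_left_invertible_injective)
  then have "W *v u \<noteq> 0" using u by (metis injD matrix_vector_mult_0_right)
  then show "0 < norm (inv_sqrt_mat S *v u)" by (simp add: W_def)
  obtain Q where Q: "orthogonal_transformation Q" "Q (W *v u) = norm (W *v u) *\<^sub>R k"
    using orthogonal_transformation_exists[of "W *v u" "norm (W *v u) *\<^sub>R k"] k by auto
  have lin: "linear (Q \<circ> (*v) W)"
    using Q by (intro linear_compose) (auto simp: orthogonal_transformation_linear)
  have inj: "inj (Q \<circ> (*v) W)"
    using Winj orthogonal_transformation_inj[OF Q(1)] by (intro inj_compose)
  have "bij (Q \<circ> (*v) W)"
    using linear_inj_imp_surj[OF lin inj] inj by (simp add: bij_def)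
  moreover have "(Q \<circ> (*v) W) x \<bullet> (Q \<circ> (*v) W) y = x \<bullet> (matrix_inv S *v y)" for x y
    using Q(1) by (simp add: orthogonal_transformation_def Wsym matrix_vector_mul_assoc WW)
  ultimately show "\<exists>T. linear T \<and> bij T \<and> (\<forall>x y. T x \<bullet> T y = x \<bullet> (matrix_inv S *v y)) \<and> T u = norm (inv_sqrt_mat S *v u) *\<^sub>R k"
    using lin Q(2) unfolding W_def by (intro exI[of _ "Q \<circ> (*v) W"]) (simp add: W_def)
qed

section \<open>Lebesgue measure under surjective linear maps\<close>

lemma nn_integral_lborel_translate:
  fixes F :: "'a::euclidean_space \<Rightarrow> ennreal"
  assumes [measurable]: "F \<in> borel_measurable borel"
  shows "(\<integral>\<^sup>+x. F (x + w) \<partial>lborel) = (\<integral>\<^sup>+x. F x \<partial>lborel)"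
proof -
  have "(\<integral>\<^sup>+x. F x \<partial>lborel) = (\<integral>\<^sup>+x. F x \<partial>distr lborel borel ((+) w))" by (simp add: lborel_distr_plus)
  also have "\<dots> = (\<integral>\<^sup>+x. F (w + x) \<partial>lborel)" by (rule nn_integral_distr) auto
  finally show ?thesis by (simp add: add.commute)
qed

text \<open>
  The usual proof that translation-invariant measures are unique, written out for the image of Lebesgue
  measure under \<open>T\<close>. Averaging over the shifts \<open>a\<close> in a box of volume one and exchanging integrals moves
  \<open>F\<close> out of the inner integral, and the remaining integral does not depend on the argument of \<open>F\<close>. The
  constant may be infinite.
\<close>

lemma nn_integral_lborel_linear_surj:
  fixes T :: "'a::euclidean_space \<Rightarrow> 'b::euclidean_space"
  assumes T: "linear T" "surj T"
  shows "\<exists>c. \<forall>F \<in> borel_measurable borel. (\<integral>\<^sup>+x. F (T x) \<partial>lborel) = c * (\<integral>\<^sup>+z. F z \<partial>lborel)"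
proof (intro exI ballI)
  let ?A = "box 0 One :: 'b set"
  fix F :: "'b \<Rightarrow> ennreal" assume F[measurable]: "F \<in> borel_measurable borel"
  have [measurable]: "T \<in> borel_measurable borel"
    using T(1) by (intro borel_measurable_continuous_onI linear_continuous_on) (simp add: linear_conv_bounded_linear)
  have shift: "(\<integral>\<^sup>+x. G (T x + a) \<partial>lborel) = (\<integral>\<^sup>+x. G (T x) \<partial>lborel)"
    if [measurable]: "G \<in> borel_measurable borel" for G :: "'b \<Rightarrow> ennreal" and a
  proof -
    obtain w where w: "T w = a" using T(2) by (metis surjD)
    have "(\<integral>\<^sup>+x. G (T x + a) \<partial>lborel) = (\<integral>\<^sup>+x. G (T (x + w)) \<partial>lborel)"
      by (simp add: linear_add[OF T(1)] w)
    also have "\<dots> = (\<integral>\<^sup>+x. G (T x) \<partial>lborel)" by (rule nn_integral_lborel_translate) simp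
    finally show ?thesis .
  qed
  \<comment> \<open>The box has volume one, so the averaging changes nothing.\<close>
  have A: "(\<integral>\<^sup>+a. indicator ?A a \<partial>lborel) = 1" by simp
  have "(\<integral>\<^sup>+x. F (T x) \<partial>lborel) = (\<integral>\<^sup>+a. indicator ?A a * (\<integral>\<^sup>+x. F (T x) \<partial>lborel) \<partial>lborel)"
    by (subst nn_integral_multc) (auto simp: A)
  also have "\<dots> = (\<integral>\<^sup>+a. \<integral>\<^sup>+x. indicator ?A a * F (T x + a) \<partial>lborel \<partial>lborel)"
    by (subst nn_integral_cmult) (auto simp: shift)
  also have "\<dots> = (\<integral>\<^sup>+x. \<integral>\<^sup>+a. indicator ?A a * F (T x + a) \<partial>lborel \<partial>lborel)"
    by (subst lborel_pair.Fubini') auto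
  also have "\<dots> = (\<integral>\<^sup>+x. \<integral>\<^sup>+z. indicator ?A (z - T x) * F z \<partial>lborel \<partial>lborel)"
  proof (rule nn_integral_cong)
    fix x
    show "(\<integral>\<^sup>+a. indicator ?A a * F (T x + a) \<partial>lborel) = (\<integral>\<^sup>+z. indicator ?A (z - T x) * F z \<partial>lborel)"
      using nn_integral_lborel_translate[of "\<lambda>z. indicator ?A (z - T x) * F z" "T x"]
      by (simp add: add.commute)
  qed
  also have "\<dots> = (\<integral>\<^sup>+z. \<integral>\<^sup>+x. indicator ?A (z - T x) * F z \<partial>lborel \<partial>lborel)"
    by (subst lborel_pair.Fubini') auto
  also have "\<dots> = (\<integral>\<^sup>+z. (\<integral>\<^sup>+x. indicator ?A (- T x) \<partial>lborel) * F z \<partial>lborel)"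
  proof (rule nn_integral_cong)
    fix z
    have "(\<integral>\<^sup>+x. indicator ?A (z - T x) \<partial>lborel) = (\<integral>\<^sup>+x. indicator ?A (- T x) \<partial>lborel :: ennreal)"
      using shift[of "\<lambda>y. indicator ?A (- y)" "- z"] by (simp add: algebra_simps)
    then show "(\<integral>\<^sup>+x. indicator ?A (z - T x) * F z \<partial>lborel) = (\<integral>\<^sup>+x. indicator ?A (- T x) \<partial>lborel) * F z"
      by (subst nn_integral_multc) auto
  qed
  also have "\<dots> = (\<integral>\<^sup>+x. indicator ?A (- T x) \<partial>lborel) * (\<integral>\<^sup>+z. F z \<partial>lborel)"
    by (rule nn_integral_cmult) simp
  finally show "(\<integral>\<^sup>+x. F (T x) \<partial>lborel) = (\<integral>\<^sup>+x. indicator ?A (- T x) \<partial>lborel) * (\<integral>\<^sup>+z. F z \<partial>lborel)" .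
qed

section \<open>Gaussian probabilities of convex sets\<close>

text \<open>
  A convex set need not be a Borel set, so the event that the vector lies in it is caught between two
  measurable events that differ by a null set.
\<close>

lemma prob_that_squeeze:
  assumes "prob_space M" and X[measurable]: "X \<in> measurable M N"
    and CD[measurable]: "C \<in> sets N" "D \<in> sets N" and sub: "C \<subseteq> S" "S \<subseteq> D"
    and null: "D - C \<in> null_sets (distr M N X)"
  shows "prob_that M (\<lambda>\<omega>. X \<omega> \<in> S) = measure (distr M N X) D"
    and "prob_that M (\<lambda>\<omega>. X \<omega> \<notin> S) = 1 - prob_that M (\<lambda>\<omega>. X \<omega> \<in> S)"
proof -
  interpret prob_space M by fact
  interpret c: prob_space "completion M"
    by (intro prob_spaceI) (simp add: emeasure_space_1)
  let ?D = "X -` D \<inter> space M" and ?S = "{\<omega> \<in> space M. X \<omega> \<in> S}"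
  have "X -` (D - C) \<inter> space M \<in> null_sets M"
    using null_sets_distr_iff[OF X] null by blast
  then have null_M: "X -` (D - C) \<inter> space M \<in> null_sets (completion M)"
    by (rule null_sets_completionI)
  have null': "?D - ?S \<in> null_sets (completion M)"
    by (rule null_sets_completion_subset[OF _ null_M]) (use sub in auto)
  have D: "?D \<in> sets M" by measurable
  have D': "?D \<in> sets (completion M)" using D by (rule sets_completionI_sets)
  have S: "?D - (?D - ?S) = ?S" using sub by auto
  have S_sets: "?S \<in> sets (completion M)"
    using sets.Diff[OF D' null_setsD2[OF null']] unfolding S .
  have "measure (completion M) ?S = measure (completion M) ?D"
    using measure_Diff_null_set[OF D' null'] unfolding S .
  then show "prob_that M (\<lambda>\<omega>. X \<omega> \<in> S) = measure (distr M N X) D"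
    using D by (simp add: prob_that_def measure_distr)
  have "{\<omega> \<in> space M. X \<omega> \<notin> S} = space (completion M) - ?S" by auto
  then show "prob_that M (\<lambda>\<omega>. X \<omega> \<notin> S) = 1 - prob_that M (\<lambda>\<omega>. X \<omega> \<in> S)"
    using c.prob_compl[OF S_sets] by (simp add: prob_that_def)
qed

text \<open>
  The boundary of a convex set is Lebesgue-negligible, so the set may be replaced by its closure, which is
  a Borel set. In particular the probability depends only on the law of the vector.
\<close>

lemma gaussian_prob_convex:
  fixes A :: "(real^'n) set"
  assumes X: "gaussian_vector M X \<mu> S" and A: "convex A"
  shows "ennreal (prob_that M (\<lambda>\<omega>. X \<omega> \<in> A))
      = (\<integral>\<^sup>+z. indicator (closure A) z * ennreal (gauss_density \<mu> S z) \<partial>lborel)"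
    and "prob_that M (\<lambda>\<omega>. X \<omega> \<notin> A) = 1 - prob_that M (\<lambda>\<omega>. X \<omega> \<in> A)"
proof -
  interpret prob_space M using X by (simp add: gaussian_vector_def)
  have d: "distr M lborel X = density lborel (\<lambda>x. ennreal (gauss_density \<mu> S x))"
    and m[measurable]: "(\<lambda>x. ennreal (gauss_density \<mu> S x)) \<in> borel_measurable lborel" "X \<in> measurable M lborel"
    using X unfolding gaussian_vector_def distributed_def by auto
  have "frontier A \<in> null_sets lborel"
    using negligible_convex_frontier[OF A] by (simp add: negligible_iff_null_sets null_sets_completion_iff)
  then have "closure A - interior A \<in> null_sets (density lborel (\<lambda>x. ennreal (gauss_density \<mu> S x)))"
    using absolutely_continuousI_density[OF m(1)] by (auto simp: frontier_def absolutely_continuous_def)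
  note squeeze = prob_that_squeeze[OF prob_space_axioms m(2) _ _ interior_subset closure_subset, unfolded d, OF _ _ this]
  show "prob_that M (\<lambda>\<omega>. X \<omega> \<notin> A) = 1 - prob_that M (\<lambda>\<omega>. X \<omega> \<in> A)"
    by (rule squeeze(2)) auto
  interpret N: prob_space "density lborel (\<lambda>x. ennreal (gauss_density \<mu> S x))"
    unfolding d[symmetric] by (rule prob_space_distr) (rule m(2))
  have "prob_that M (\<lambda>\<omega>. X \<omega> \<in> A) = measure (density lborel (\<lambda>x. ennreal (gauss_density \<mu> S x))) (closure A)"
    by (rule squeeze(1)) auto
  then show "ennreal (prob_that M (\<lambda>\<omega>. X \<omega> \<in> A))
      = (\<integral>\<^sup>+z. indicator (closure A) z * ennreal (gauss_density \<mu> S z) \<partial>lborel)"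
    by (simp add: N.emeasure_eq_measure[symmetric] emeasure_density mult.commute)
qed

lemma gaussian_prob_convex_eq:
  fixes A :: "(real^'n) set"
  assumes "gaussian_vector M X \<mu> S" "gaussian_vector N Y \<mu> S" "convex A"
  shows "prob_that M (\<lambda>\<omega>. X \<omega> \<in> A) = prob_that N (\<lambda>\<omega>. Y \<omega> \<in> A)"
proof -
  have "ennreal (prob_that M (\<lambda>\<omega>. X \<omega> \<in> A)) = ennreal (prob_that N (\<lambda>\<omega>. Y \<omega> \<in> A))"
    by (simp only: gaussian_prob_convex(1)[OF assms(1,3)] gaussian_prob_convex(1)[OF assms(2,3)])
  then show ?thesis
    unfolding prob_that_def by (subst (asm) ennreal_inj) (rule measure_nonneg)+
qed

lemma gaussian_vector_translate:
  assumes X: "gaussian_vector M X \<mu> S"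
  shows "gaussian_vector M (\<lambda>\<omega>. X \<omega> + w) (\<mu> + w) S"
proof -
  have d: "distr M lborel X = density lborel (\<lambda>x. ennreal (gauss_density \<mu> S x))"
    and m[measurable]: "(\<lambda>x. ennreal (gauss_density \<mu> S x)) \<in> borel_measurable borel" "X \<in> borel_measurable M"
    using X unfolding gaussian_vector_def distributed_def by auto
  have g: "gauss_density (\<mu> + w) S x = gauss_density \<mu> S (x - w)" for x
    by (simp add: gauss_density_def algebra_simps)
  have [measurable]: "(\<lambda>x. ennreal (gauss_density (\<mu> + w) S x)) \<in> borel_measurable borel"
    unfolding g by measurable
  have "distr M lborel (\<lambda>\<omega>. X \<omega> + w) = distr (distr M lborel X) lborel (\<lambda>x. x + w)"
    by (subst distr_distr) (auto simp: comp_def)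
  also have "\<dots> = density lborel (\<lambda>x. ennreal (gauss_density (\<mu> + w) S x))"
  proof (rule measure_eqI)
    fix B assume "B \<in> sets (distr (distr M lborel X) lborel (\<lambda>x. x + w))"
    then have [measurable]: "B \<in> sets borel" by simp
    have "emeasure (distr (distr M lborel X) lborel (\<lambda>x. x + w)) B
        = (\<integral>\<^sup>+x. indicator B x \<partial>distr (distr M lborel X) lborel (\<lambda>x. x + w))"
      by simp
    also have "\<dots> = (\<integral>\<^sup>+x. indicator B (x + w) \<partial>density lborel (\<lambda>x. ennreal (gauss_density \<mu> S x)))"
      unfolding d by (rule nn_integral_distr) auto
    also have "\<dots> = (\<integral>\<^sup>+x. ennreal (gauss_density \<mu> S (x + w - w)) * indicator B (x + w) \<partial>lborel)"
      by (subst nn_integral_density) auto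
    also have "\<dots> = (\<integral>\<^sup>+x. ennreal (gauss_density \<mu> S (x - w)) * indicator B x \<partial>lborel)"
      by (rule nn_integral_lborel_translate) simp
    also have "\<dots> = emeasure (density lborel (\<lambda>x. ennreal (gauss_density (\<mu> + w) S x))) B"
      by (simp add: emeasure_density g)
    finally show "emeasure (distr (distr M lborel X) lborel (\<lambda>x. x + w)) B
      = emeasure (density lborel (\<lambda>x. ennreal (gauss_density (\<mu> + w) S x))) B" .
  qed simp
  finally show ?thesis
    using X unfolding gaussian_vector_def distributed_def by auto
qed

section \<open>Increments of the normal distribution function\<close>

text \<open>
  The reflection \<open>s \<mapsto> t - s\<close> turns the increment around \<open>t\<close> into the integral of the shifted weight over a
  centred interval.
\<close>

lemma std_normal_cdf_diff:
  assumes "0 < a"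
  shows "ennreal (std_normal_cdf (t + a) - std_normal_cdf (t - a))
    = ennreal (1 / sqrt (2 * pi)) * (\<integral>\<^sup>+s. indicator {- a..a} s * ennreal (exp (- (s - t)\<^sup>2 / 2)) \<partial>lborel)"
proof -
  interpret real_distribution std_normal_distribution by (rule real_dist_normal_dist)
  have e: "ennreal (std_normal_density x) = ennreal (1 / sqrt (2 * pi)) * ennreal (exp (- x\<^sup>2 / 2))" for x
    by (simp add: normal_density_def ennreal_mult[symmetric])
  have "std_normal_cdf (t + a) - std_normal_cdf (t - a) = measure std_normal_distribution {t - a<..t + a}"
    unfolding std_normal_cdf_def using assms by (intro cdf_diff_eq) auto
  then have "ennreal (std_normal_cdf (t + a) - std_normal_cdf (t - a)) = emeasure std_normal_distribution {t - a<..t + a}"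
    by (simp add: emeasure_eq_measure)
  also have "\<dots> = (\<integral>\<^sup>+x. ennreal (1 / sqrt (2 * pi)) * (indicator {t - a<..t + a} x * ennreal (exp (- x\<^sup>2 / 2))) \<partial>lborel)"
    by (subst emeasure_density) (auto simp: e mult_ac intro!: nn_integral_cong)
  also have "\<dots> = ennreal (1 / sqrt (2 * pi)) * (\<integral>\<^sup>+x. indicator {t - a<..t + a} x * ennreal (exp (- x\<^sup>2 / 2)) \<partial>lborel)"
    by (rule nn_integral_cmult) simp
  also have "(\<integral>\<^sup>+x. indicator {t - a<..t + a} x * ennreal (exp (- x\<^sup>2 / 2)) \<partial>lborel)
      = (\<integral>\<^sup>+s. indicator {t - a<..t + a} (t + - 1 * s) * ennreal (exp (- (t + - 1 * s)\<^sup>2 / 2)) \<partial>lborel)"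
    by (subst nn_integral_real_affine[where c="-1" and t=t]) auto
  also have "\<dots> = (\<integral>\<^sup>+s. indicator {- a..a} s * ennreal (exp (- (s - t)\<^sup>2 / 2)) \<partial>lborel)"
  proof (rule nn_integral_cong_AE)
    show "AE s in lborel. indicator {t - a<..t + a} (t + - 1 * s) * ennreal (exp (- (t + - 1 * s)\<^sup>2 / 2))
      = indicator {- a..a} s * ennreal (exp (- (s - t)\<^sup>2 / 2))"
      using AE_lborel_singleton[of a]
      by eventually_elim (auto simp: indicator_def power2_commute[of _ t])
  qed
  finally show ?thesis .
qed

lemma std_gaussian_integral: "ennreal (1 / sqrt (2 * pi)) * (\<integral>\<^sup>+s. ennreal (exp (- (s - t)\<^sup>2 / 2)) \<partial>lborel) = 1"
proof -
  interpret prob_space "density lborel (\<lambda>x. ennreal (normal_density t 1 x))"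
    by (rule prob_space_normal_density) simp
  have e: "ennreal (1 / sqrt (2 * pi)) * ennreal (exp (- (x - t)\<^sup>2 / 2)) = ennreal (normal_density t 1 x)" for x
    by (simp add: normal_density_def ennreal_mult[symmetric])
  have "ennreal (1 / sqrt (2 * pi)) * (\<integral>\<^sup>+s. ennreal (exp (- (s - t)\<^sup>2 / 2)) \<partial>lborel)
    = (\<integral>\<^sup>+s. ennreal (normal_density t 1 s) \<partial>lborel)"
    unfolding e[symmetric] by (rule nn_integral_cmult[symmetric]) measurable
  also have "\<dots> = 1" using emeasure_space_1 by (simp add: emeasure_density)
  finally show ?thesis .
qed

text \<open>
  The second bound, which makes the function \<open>r\<close> at most 1, is the association inequality for the
  indicator of the interval under the Gaussian weight on the whole line, where both shifted
  integrals agree.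
\<close>

lemma std_normal_cdf_diff_bounds:
  assumes a: "0 < a"
  shows "0 < std_normal_cdf a - std_normal_cdf (- a)"
    and "std_normal_cdf (t + a) - std_normal_cdf (t - a) \<le> std_normal_cdf a - std_normal_cdf (- a)"
proof -
  let ?J = "\<lambda>t. \<integral>\<^sup>+s. indicator {- a..a} s * ennreal (exp (- (s - t)\<^sup>2 / 2)) \<partial>lborel"
  let ?K = "ennreal (1 / sqrt (2 * pi))"
  have D0: "ennreal (std_normal_cdf a - std_normal_cdf (- a)) = ?K * ?J 0"
    using std_normal_cdf_diff[OF a, of 0] by simp
  have "0 < ennreal (exp (- a\<^sup>2 / 2)) * ennreal (2 * a)"
    using a by (simp add: ennreal_mult[symmetric])
  also have "\<dots> = (\<integral>\<^sup>+s. ennreal (exp (- a\<^sup>2 / 2)) * indicator {- a..a} s \<partial>lborel)"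
    using a by (subst nn_integral_cmult_indicator) auto
  also have "\<dots> \<le> ?J 0"
  proof (rule nn_integral_mono)
    fix s
    show "ennreal (exp (- a\<^sup>2 / 2)) * indicator {- a..a} s \<le> indicator {- a..a} s * ennreal (exp (- (s - 0)\<^sup>2 / 2))"
      by (auto simp: indicator_def abs_le_square_iff[symmetric] intro!: ennreal_leI)
  qed
  finally have "0 < ?K * ?J 0"
    by (simp add: ennreal_zero_less_mult_iff)
  then show pos: "0 < std_normal_cdf a - std_normal_cdf (- a)"
    unfolding D0[symmetric] by simp
  let ?G = "\<lambda>t. \<integral>\<^sup>+s. ennreal (exp (- (s - t)\<^sup>2 / 2)) \<partial>lborel"
  have "?J t * ?G 0 \<le> ?G t * ?J 0"
  proof -
    have "indicator {- a..a} r \<le> (indicator {- a..a} s :: ennreal)" if "\<bar>s\<bar> \<le> \<bar>r\<bar>" for s r :: real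
      using that by (simp add: indicator_def abs_le_iff) linarith
    from shifted_gaussian_unimodal_le[OF _ _ this, where I=UNIV and t=t] show ?thesis by simp
  qed
  then have "(?K * ?K) * (?J t * ?G 0) \<le> (?K * ?K) * (?G t * ?J 0)" by (rule mult_left_mono) simp
  then have "(?K * ?J t) * (?K * ?G 0) \<le> (?K * ?G t) * (?K * ?J 0)" by (simp only: mult_ac)
  then have "?K * ?J t \<le> ?K * ?J 0"
    by (simp only: std_gaussian_integral mult_1_left mult_1_right)
  then show "std_normal_cdf (t + a) - std_normal_cdf (t - a) \<le> std_normal_cdf a - std_normal_cdf (- a)"
    unfolding D0[symmetric] std_normal_cdf_diff[OF a, symmetric] using pos by (simp add: ennreal_le_iff)
qed

section \<open>Acceptance probabilities at a shifted mean\<close>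

text \<open>
  Whitening turns both probabilities into the same constant \<open>K\<close> times integrals of shifted standard Gaussian
  weights over \<open>B\<close>. The heights of \<open>B\<close> along \<open>k\<close> are the values \<open>x \<bullet> (matrix_inv S *v u) / n\<close>, so their
  supremum is \<open>a_coef S A u\<close>.
\<close>

lemma gaussian_prob_shift_bounds:
  fixes S :: "real^'n^'n" and u :: "real^'n" and A :: "(real^'n) set"
  assumes S: "pos_def_mat S" and u: "u \<noteq> 0" and A: "convex A" "uminus ` A = A"
    and X: "gaussian_vector M X 0 S" and Y: "gaussian_vector N Y (\<theta> *\<^sub>R u) S"
    and pos: "0 < prob_that M (\<lambda>\<omega>. X \<omega> \<in> A)"
  defines "\<tau> \<equiv> \<theta> * norm (inv_sqrt_mat S *v u)"
  shows "exp (- (\<theta>\<^sup>2 * (u \<bullet> (matrix_inv S *v u))) / 2) * prob_that M (\<lambda>\<omega>. X \<omega> \<in> A) \<le> prob_that N (\<lambda>\<omega>. Y \<omega> \<in> A)"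
    and "0 \<le> a_coef S A u"
    and "prob_that N (\<lambda>\<omega>. Y \<omega> \<in> A) \<le> r_fun \<tau> (a_coef S A u) * prob_that M (\<lambda>\<omega>. X \<omega> \<in> A)"
    and "r_fun \<tau> (a_coef S A u) \<le> 1"
proof -
  let ?p0 = "prob_that M (\<lambda>\<omega>. X \<omega> \<in> A)" and ?pt = "prob_that N (\<lambda>\<omega>. Y \<omega> \<in> A)"
  define a where "a = a_coef S A u"
  define n where "n = norm (inv_sqrt_mat S *v u)"
  obtain k :: "real^'n" where k: "k \<in> Basis" using nonempty_Basis by blast
  have n: "0 < n" unfolding n_def by (rule whitening_map_exists(1)[OF S u norm_Basis[OF k]])
  obtain T where T: "linear T" "bij T" "\<And>x y. T x \<bullet> T y = x \<bullet> (matrix_inv S *v y)" "T u = n *\<^sub>R k"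
    using whitening_map_exists(2)[OF S u norm_Basis[OF k]] unfolding n_def by blast
  have n_sq: "u \<bullet> (matrix_inv S *v u) = n\<^sup>2"
    using T(3)[of u u] k by (simp add: T(4) inner_Basis power2_eq_square)
  define B where "B = T ` closure A"
  have B_closed: "closed B"
    unfolding B_def using T(1,2) by (intro closed_injective_linear_image) (auto simp: bij_is_inj)
  then have B_borel[measurable]: "B \<in> sets borel" by simp
  have B_convex: "convex B"
    unfolding B_def using T(1) A(1) by (intro convex_linear_image convex_closure)
  have C_sym: "uminus ` closure A = closure A"
    using closure_scaleR[of "-1" A] A(2) by simp
  have B_sym: "- z \<in> B \<longleftrightarrow> z \<in> B" for z
  proof -
    have "- z \<in> B" if "z \<in> B" for z
    proof -
      from that obtain x where x: "x \<in> closure A" "z = T x" unfolding B_def by blast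
      then have "- z = T (- x)" "- x \<in> closure A"
        using linear_neg[OF T(1)] C_sym by auto
      then show ?thesis unfolding B_def by blast
    qed
    from this[of z] this[of "- z"] show ?thesis by auto
  qed
  have B_iff: "T x \<in> B \<longleftrightarrow> x \<in> closure A" for x
    unfolding B_def using T(2) by (simp add: inj_image_mem_iff bij_is_inj)
  let ?W = "\<lambda>t. \<integral>\<^sup>+z. indicator B z * ennreal (exp (- (norm (z - t *\<^sub>R k))\<^sup>2 / 2)) \<partial>lborel"
  obtain c where c: "\<And>F. F \<in> borel_measurable borel \<Longrightarrow> (\<integral>\<^sup>+x. F (T x) \<partial>lborel) = c * (\<integral>\<^sup>+z. F z \<partial>lborel)"
    using nn_integral_lborel_linear_surj[OF T(1) bij_is_surj[OF T(2)]] by blast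
  define q where "q = 1 / sqrt ((2 * pi) ^ CARD('n) * det S)"
  \<comment> \<open>\<open>K\<close> collects the normalising constant and the Jacobian; it cancels from all comparisons.\<close>
  define K where "K = ennreal q * c"
  have prob_eq: "ennreal (prob_that L (\<lambda>\<omega>. Z \<omega> \<in> A)) = K * ?W (h * n)"
    if Z: "gaussian_vector L Z (h *\<^sub>R u) S" for L :: "'l measure" and Z h
  proof -
    have dens: "ennreal (gauss_density (h *\<^sub>R u) S x) = ennreal q * ennreal (exp (- (norm (T x - (h * n) *\<^sub>R k))\<^sup>2 / 2))" for x
    proof -
      have "(x - h *\<^sub>R u) \<bullet> (matrix_inv S *v (x - h *\<^sub>R u)) = (norm (T x - (h * n) *\<^sub>R k))\<^sup>2"
        unfolding T(3)[symmetric] power2_norm_eq_inner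
        by (simp add: linear_diff[OF T(1)] linear_cmul[OF T(1)] T(4))
      then show ?thesis by (simp add: gauss_density_def q_def ennreal_mult''[symmetric])
    qed
    have "ennreal (prob_that L (\<lambda>\<omega>. Z \<omega> \<in> A))
      = (\<integral>\<^sup>+x. (\<lambda>z. ennreal q * (indicator B z * ennreal (exp (- (norm (z - (h * n) *\<^sub>R k))\<^sup>2 / 2)))) (T x) \<partial>lborel)"
      unfolding gaussian_prob_convex(1)[OF Z A(1)] dens
      by (intro nn_integral_cong) (simp add: indicator_def B_iff)
    also have "\<dots> = c * (\<integral>\<^sup>+z. ennreal q * (indicator B z * ennreal (exp (- (norm (z - (h * n) *\<^sub>R k))\<^sup>2 / 2))) \<partial>lborel)"
      by (rule c) measurable
    also have "\<dots> = K * ?W (h * n)"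
      by (subst nn_integral_cmult) (auto simp: K_def mult_ac)
    finally show ?thesis .
  qed
  have p0: "ennreal ?p0 = K * (\<integral>\<^sup>+z. indicator B z * ennreal (exp (- (norm z)\<^sup>2 / 2)) \<partial>lborel)"
    using prob_eq[of M X 0] X by simp
  have pt: "ennreal ?pt = K * ?W \<tau>"
    unfolding \<tau>_def n_def[symmetric] by (rule prob_eq[OF Y])
  have pt0: "0 \<le> ?pt" by (simp add: prob_that_def)

  have "ennreal (exp (- \<tau>\<^sup>2 / 2)) * ennreal ?p0 \<le> ennreal ?pt"
    unfolding p0 pt using mult_left_mono[OF shifted_gaussian_symmetric_ge[OF B_borel B_sym k, of \<tau>], of K]
    by (simp add: mult.left_commute)
  then have "ennreal (exp (- \<tau>\<^sup>2 / 2) * ?p0) \<le> ennreal ?pt"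
    using pos by (simp add: ennreal_mult)
  then have "exp (- \<tau>\<^sup>2 / 2) * ?p0 \<le> ?pt" using pt0 by (simp add: ennreal_le_iff)
  then show "exp (- (\<theta>\<^sup>2 * (u \<bullet> (matrix_inv S *v u))) / 2) * ?p0 \<le> ?pt"
    by (simp add: n_sq \<tau>_def n_def[symmetric] power_mult_distrib)

  have upper: "ennreal ?pt * (\<integral>\<^sup>+s. indicator I s * ennreal (exp (- s\<^sup>2 / 2)) \<partial>lborel)
      \<le> (\<integral>\<^sup>+s. indicator I s * ennreal (exp (- (s - \<tau>)\<^sup>2 / 2)) \<partial>lborel) * ennreal ?p0"
    if "I \<in> sets borel" "\<And>s. - s \<in> I \<longleftrightarrow> s \<in> I" "\<And>z. z \<in> B \<Longrightarrow> z \<bullet> k \<in> I" for I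
    unfolding p0 pt
    using mult_left_mono[OF shifted_gaussian_symmetric_convex_le[OF B_borel that(1) B_convex B_sym k that(2,3), of \<tau>], of K]
    by (simp add: mult_ac)

  have Ane: "A \<noteq> {}" using pos by (auto simp: prob_that_def)
  have zero_A: "0 \<in> A"
  proof -
    obtain x where "x \<in> A" using Ane by blast
    moreover from this have "- x \<in> A" using A(2) by blast
    ultimately have "(1/2) *\<^sub>R x + (1/2) *\<^sub>R (- x) \<in> A"
      by (intro convexD[OF A(1)]) auto
    then show ?thesis by simp
  qed
  have a_def': "a = support_fun (matrix_inv S *v u) A / ereal n" by (simp add: a_def a_coef_def n_def)
  have a_upper: "ereal (x \<bullet> (matrix_inv S *v u) / n) \<le> a" if "x \<in> A" for x
  proof -
    have "ereal (x \<bullet> (matrix_inv S *v u)) \<le> support_fun (matrix_inv S *v u) A"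
      unfolding support_fun_def using that by (rule SUP_upper)
    then have "ereal (x \<bullet> (matrix_inv S *v u)) / ereal n \<le> a"
      unfolding a_def' using n by (intro ereal_divide_right_mono) auto
    then show ?thesis using n by simp
  qed
  show a_nonneg: "0 \<le> a_coef S A u"
    using a_upper[OF zero_A] by (simp add: a_def zero_ereal_def)
  have inner_k: "T x \<bullet> k = x \<bullet> (matrix_inv S *v u) / n" for x
    using T(3)[of x u] n by (simp add: T(4) field_simps)
  have B_le: "z \<bullet> k \<le> a'" if a': "a = ereal a'" and z: "z \<in> B" for z a'
  proof -
    have "A \<subseteq> {x. x \<bullet> (matrix_inv S *v u) \<le> a' * n}"
      using a_upper n unfolding a' by (auto simp: field_simps)
    moreover have "closed {x. x \<bullet> (matrix_inv S *v u) \<le> a' * n}"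
      by (intro closed_Collect_le continuous_intros)
    ultimately have "closure A \<subseteq> {x. x \<bullet> (matrix_inv S *v u) \<le> a' * n}" by (rule closure_minimal)
    then show ?thesis using z n unfolding B_def by (auto simp: inner_k field_simps)
  qed
  have B_abs: "z \<bullet> k \<in> {- a'..a'}" if a': "a = ereal a'" and z: "z \<in> B" for z a'
    using B_le[OF a' z] B_le[OF a', of "- z"] z B_sym by auto

  \<comment> \<open>For \<open>a = \<infinity>\<close> the whole line serves as the interval of heights, otherwise \<open>{- a..a}\<close>.\<close>
  have "?pt \<le> r_fun \<tau> a * ?p0 \<and> r_fun \<tau> a \<le> 1"
  proof (cases a)
    case PInf
    have "ennreal (1 / sqrt (2 * pi)) * (ennreal ?pt * (\<integral>\<^sup>+s. ennreal (exp (- s\<^sup>2 / 2)) \<partial>lborel))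
       \<le> ennreal (1 / sqrt (2 * pi)) * ((\<integral>\<^sup>+s. ennreal (exp (- (s - \<tau>)\<^sup>2 / 2)) \<partial>lborel) * ennreal ?p0)"
      using upper[of UNIV] by (intro mult_left_mono) simp_all
    then have "(ennreal (1 / sqrt (2 * pi)) * (\<integral>\<^sup>+s. ennreal (exp (- (s - 0)\<^sup>2 / 2)) \<partial>lborel)) * ennreal ?pt
       \<le> (ennreal (1 / sqrt (2 * pi)) * (\<integral>\<^sup>+s. ennreal (exp (- (s - \<tau>)\<^sup>2 / 2)) \<partial>lborel)) * ennreal ?p0"
      by (simp only: mult_ac diff_0_right)
    then have "?pt \<le> ?p0"
      unfolding std_gaussian_integral using pos by (simp add: ennreal_le_iff)
    then show ?thesis using PInf by (simp add: r_fun_def)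
  next
    case MInf
    then show ?thesis using a_nonneg by (simp add: a_def)
  next
    case (real a')
    then have "0 \<le> a'" using a_nonneg by (simp add: a_def[symmetric])
    \<comment> \<open>For \<open>a = 0\<close> the set \<open>B\<close> would lie in a hyperplane and have probability zero.\<close>
    moreover have "a' \<noteq> 0"
    proof
      assume "a' = 0"
      then have "B \<subseteq> {z. k \<bullet> z = 0}" using B_abs[OF real] by (force simp: inner_commute)
      moreover have "k \<noteq> 0" using k by auto
      ultimately have "negligible B"
        using negligible_hyperplane[of k 0] negligible_subset by blast
      then have "B \<in> null_sets lborel"
        by (simp add: negligible_iff_null_sets null_sets_completion_iff)
      then have "AE z in lborel. indicator B z * ennreal (exp (- (norm z)\<^sup>2 / 2)) = 0"
        by (auto dest!: AE_not_in elim!: eventually_mono)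
      then have "(\<integral>\<^sup>+z. indicator B z * ennreal (exp (- (norm z)\<^sup>2 / 2)) \<partial>lborel) = 0"
        by (subst nn_integral_0_iff_AE) auto
      then have "ennreal ?p0 = 0" unfolding p0 by simp
      then show False using pos by simp
    qed
    ultimately have a': "0 < a'" by simp
    let ?D = "\<lambda>t. std_normal_cdf (t + a') - std_normal_cdf (t - a')"
    note D0 = std_normal_cdf_diff_bounds(1)[OF a']
    note D_le = std_normal_cdf_diff_bounds(2)[OF a', of \<tau>]
    have "ennreal (1 / sqrt (2 * pi)) * (ennreal ?pt * (\<integral>\<^sup>+s. indicator {- a'..a'} s * ennreal (exp (- s\<^sup>2 / 2)) \<partial>lborel))
       \<le> ennreal (1 / sqrt (2 * pi)) * ((\<integral>\<^sup>+s. indicator {- a'..a'} s * ennreal (exp (- (s - \<tau>)\<^sup>2 / 2)) \<partial>lborel) * ennreal ?p0)"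
    proof (rule mult_left_mono[OF upper])
      show "- s \<in> {- a'..a'} \<longleftrightarrow> s \<in> {- a'..a'}" for s by auto
    qed (use B_abs[OF real] in auto)
    then have "ennreal (?D 0) * ennreal ?pt \<le> ennreal (?D \<tau>) * ennreal ?p0"
      unfolding std_normal_cdf_diff[OF a'] by (simp only: mult_ac diff_0_right)
    then have "?D 0 * ?pt \<le> ?D \<tau> * ?p0"
    proof -
      interpret real_distribution std_normal_distribution by (rule real_dist_normal_dist)
      have "0 \<le> ?D \<tau>" using a' by (simp add: std_normal_cdf_def cdf_nondecreasing)
      then show ?thesis
        using \<open>ennreal (?D 0) * ennreal ?pt \<le> ennreal (?D \<tau>) * ennreal ?p0\<close> D0 pos pt0
        by (simp add: ennreal_mult[symmetric] ennreal_le_iff)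
    qed
    then have "?pt \<le> ?D \<tau> / ?D 0 * ?p0"
      using D0 by (simp add: field_simps)
    moreover have "?D \<tau> / ?D 0 \<le> 1" using D0 D_le by simp
    ultimately show ?thesis using real a' by (simp add: r_fun_def)
  qed
  then show "?pt \<le> r_fun \<tau> (a_coef S A u) * ?p0" "r_fun \<tau> (a_coef S A u) \<le> 1"
    by (simp_all add: a_def)
qed
theorem corollary2p15:
  fixes \<Sigma> :: "real^'n^'n" and u :: "real^'n" and A :: "(real^'n) set"
    and M :: "'v measure" and X :: "'v \<Rightarrow> real^'n"
    and P :: "real \<Rightarrow> 'w measure" and Y :: "'w \<Rightarrow> real^'n"
    and \<alpha> \<theta> :: real and \<beta> :: "real \<Rightarrow> real"
  assumes "pos_semidef_mat \<Sigma>" and "invertible \<Sigma>"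
    and "gaussian_vector M X 0 \<Sigma>"
    and "\<And>t. 0 \<le> t \<Longrightarrow> gaussian_vector (P t) Y (t *\<^sub>R u) \<Sigma>"
    and "norm u = 1"
    and "convex A" and "uminus ` A = A"
    and "prob_that M (\<lambda>\<omega>. X \<omega> \<in> A) > 0"
    and "\<alpha> = prob_that M (\<lambda>\<omega>. X \<omega> \<notin> A)"
    and "\<And>t. 0 < t \<Longrightarrow> \<beta> t = reject_prob (P t) Y (test A)"
    and "\<theta> > 0"
  shows "reject_prob (P 0) Y (test A) = \<alpha>
    \<and> \<beta> \<theta> = prob_that (P \<theta>) (\<lambda>\<omega>. Y \<omega> \<notin> A)
    \<and> \<beta> \<theta> = prob_that M (\<lambda>\<omega>. X \<omega> \<notin> (\<lambda>z. z - \<theta> *\<^sub>R u) ` A)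
    \<and> \<beta> \<theta> = 1 - prob_that M (\<lambda>\<omega>. X \<omega> \<in> (\<lambda>z. z - \<theta> *\<^sub>R u) ` A)
    \<and> 0 \<le> a_coef \<Sigma> A u
    \<and> 1 - exp (- (\<theta>\<^sup>2 * (u \<bullet> (matrix_inv \<Sigma> *v u))) / 2) * (1 - \<alpha>) \<ge> \<beta> \<theta>
    \<and> \<beta> \<theta> \<ge> 1 - r_fun (\<theta> * norm (inv_sqrt_mat \<Sigma> *v u)) (a_coef \<Sigma> A u) * (1 - \<alpha>)
    \<and> 1 - r_fun (\<theta> * norm (inv_sqrt_mat \<Sigma> *v u)) (a_coef \<Sigma> A u) * (1 - \<alpha>) \<ge> \<alpha>"
proof -
  have S: "pos_def_mat \<Sigma>"
    using assms(1,2) by (rule invertible_pos_semidef_imp_pos_def)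
  have u: "u \<noteq> 0" using assms(5) by auto
  note A = assms(6)
  have P0: "gaussian_vector (P 0) Y 0 \<Sigma>" using assms(4)[of 0] by simp
  have P\<theta>: "gaussian_vector (P \<theta>) Y (\<theta> *\<^sub>R u) \<Sigma>" using assms(4,11) by simp
  have rej: "reject_prob (P t) Y (test A) = prob_that (P t) (\<lambda>\<omega>. Y \<omega> \<notin> A)" for t
    by (simp add: reject_prob_def test_def)
  let ?p0 = "prob_that M (\<lambda>\<omega>. X \<omega> \<in> A)" and ?pt = "prob_that (P \<theta>) (\<lambda>\<omega>. Y \<omega> \<in> A)"
  have \<alpha>: "1 - \<alpha> = ?p0"
    unfolding assms(9) gaussian_prob_convex(2)[OF assms(3) A] by simp
  have \<beta>: "\<beta> \<theta> = prob_that (P \<theta>) (\<lambda>\<omega>. Y \<omega> \<notin> A)"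
    using assms(10,11) rej by simp
  then have \<beta>': "\<beta> \<theta> = 1 - ?pt"
    by (simp only: gaussian_prob_convex(2)[OF P\<theta> A])
  have size: "reject_prob (P 0) Y (test A) = \<alpha>"
    unfolding rej assms(9) gaussian_prob_convex(2)[OF P0 A] gaussian_prob_convex(2)[OF assms(3) A]
    by (simp only: gaussian_prob_convex_eq[OF P0 assms(3) A])
  have shift: "X \<omega> \<in> (\<lambda>z. z - \<theta> *\<^sub>R u) ` A \<longleftrightarrow> X \<omega> + \<theta> *\<^sub>R u \<in> A" for \<omega>
    by (force simp: image_iff algebra_simps)
  have X\<theta>: "gaussian_vector M (\<lambda>\<omega>. X \<omega> + \<theta> *\<^sub>R u) (\<theta> *\<^sub>R u) \<Sigma>"
    using gaussian_vector_translate[OF assms(3), of "\<theta> *\<^sub>R u"] by simp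
  have in_shift: "prob_that M (\<lambda>\<omega>. X \<omega> \<in> (\<lambda>z. z - \<theta> *\<^sub>R u) ` A) = ?pt"
    unfolding shift by (rule gaussian_prob_convex_eq[OF X\<theta> P\<theta> A])
  have notin_shift: "prob_that M (\<lambda>\<omega>. X \<omega> \<notin> (\<lambda>z. z - \<theta> *\<^sub>R u) ` A) = 1 - ?pt"
    unfolding in_shift[symmetric] unfolding shift by (rule gaussian_prob_convex(2)[OF X\<theta> A])
  note bounds = gaussian_prob_shift_bounds[OF S u A assms(7) assms(3) P\<theta> assms(8)]
  have "r_fun (\<theta> * norm (inv_sqrt_mat \<Sigma> *v u)) (a_coef \<Sigma> A u) * ?p0 \<le> 1 * ?p0"
    using bounds(4) assms(8) by (intro mult_right_mono) auto
  then show ?thesis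
    using size \<beta> \<beta>' in_shift notin_shift bounds(1-3) \<alpha> by auto
qed

end
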